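(* Let $G=\mathbb{Z}^k\oplus F$ with $F$ a finite group, and let $\phi:G\to G$ be an endomorphism with $R(\phi)<\infty$. Then $F$ is exactly the set of torsion elements of $G$, so $\phi(F)\subset F$; let $\phi^{tors}:F\to F$ be the restriction and $\phi^\infty:G/F\to G/F$ the induced endomorphism of $G/F\cong\mathbb{Z}^k$. Let $W$ be the complex vector space of complex-valued class functions on $F$ and $B:W\to W$, $B(h)=h\circ\phi^{tors}$. Let $p$ be the number of eigenvalues $\mu$ of $\phi^\infty$ with $\mu<-1$, and $r$ the number of real eigenvalues of $\phi^\infty$ with $|\mu|>1$. Then $$R(\phi)=(-1)^{r+p}\sum_{i=0}^{k}(-1)^i\,\mathrm{Tr}\big(\Lambda^i\phi^\infty\otimes B\big).$$
   Context: Two elements $\alpha,\alpha'\in G$ are $\phi$-conjugate if $\alpha'=\gamma\alpha\phi(\gamma)^{-1}$ for some $\gamma\in G$; the Reidemeister number $R(\phi)$ is the number of $\phi$-conjugacy classes. $\Lambda^i\phi^\infty$ denotes the $i$-th exterior power of $\phi^\infty\otimes\mathbb{C}$ on $\Lambda^i(\mathbb{C}^k)$. *)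

theory Defs
  imports "HOL-Algebra.Group" "Jordan_Normal_Form.Char_Poly" "Jordan_Normal_Form.DL_Submatrix"
begin

definition Zk :: "nat \<Rightarrow> (nat \<Rightarrow> int) set" where
  "Zk k = {v. \<forall>i\<ge>k. v i = 0}"

definition unit_vec_Z :: "nat \<Rightarrow> nat \<Rightarrow> int" where
  "unit_vec_Z j = (\<lambda>i. if i = j then 1 else 0)"

definition ZkF :: "nat \<Rightarrow> ('a, 'b) monoid_scheme \<Rightarrow> ((nat \<Rightarrow> int) \<times> 'a) monoid" where
  "ZkF k F = \<lparr> carrier = {(v, x). v \<in> Zk k \<and> x \<in> carrier F},
              mult = (\<lambda>(v, x) (w, y). (\<lambda>i. v i + w i, x \<otimes>\<^bsub>F\<^esub> y)),
              one = (\<lambda>_. 0, \<one>\<^bsub>F\<^esub>) \<rparr>"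

definition phi_conj :: "('g, 'c) monoid_scheme \<Rightarrow> ('g \<Rightarrow> 'g) \<Rightarrow> 'g \<Rightarrow> 'g \<Rightarrow> bool" where
  "phi_conj G \<phi> a a' \<longleftrightarrow>
     (\<exists>\<gamma>\<in>carrier G. a' = \<gamma> \<otimes>\<^bsub>G\<^esub> a \<otimes>\<^bsub>G\<^esub> inv\<^bsub>G\<^esub> (\<phi> \<gamma>))"

definition reidemeister_classes :: "('g, 'c) monoid_scheme \<Rightarrow> ('g \<Rightarrow> 'g) \<Rightarrow> 'g set set" where
  "reidemeister_classes G \<phi> = (\<lambda>a. {a' \<in> carrier G. phi_conj G \<phi> a a'}) ` carrier G"

definition torsion_elems :: "('g, 'c) monoid_scheme \<Rightarrow> 'g set" where
  "torsion_elems G = {x \<in> carrier G. \<exists>n::nat. n > 0 \<and> x [^]\<^bsub>G\<^esub> n = \<one>\<^bsub>G\<^esub>}"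

definition phi_tors :: "('a, 'b) monoid_scheme \<Rightarrow> ((nat \<Rightarrow> int) \<times> 'a \<Rightarrow> (nat \<Rightarrow> int) \<times> 'a) \<Rightarrow> 'a \<Rightarrow> 'a" where
  "phi_tors F \<phi> x = snd (\<phi> (\<lambda>_. 0, x))"

text \<open>phi^infinity : G/F -> G/F, under G/F = Z^k via (v,x) F |-> v, as an integer
  k x k matrix w.r.t. the standard basis (column j = image of e_j), taken in C.\<close>
definition phi_inf_mat :: "nat \<Rightarrow> ('a, 'b) monoid_scheme \<Rightarrow> ((nat \<Rightarrow> int) \<times> 'a \<Rightarrow> (nat \<Rightarrow> int) \<times> 'a) \<Rightarrow> complex mat" where
  "phi_inf_mat k F \<phi> = mat k k (\<lambda>(i, j). of_int (fst (\<phi> (unit_vec_Z j, \<one>\<^bsub>F\<^esub>)) i))"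

definition eig_count :: "complex mat \<Rightarrow> (complex \<Rightarrow> bool) \<Rightarrow> nat" where
  "eig_count M P = (\<Sum>\<mu>\<in>{\<mu>. poly (char_poly M) \<mu> = 0 \<and> P \<mu>}. order \<mu> (char_poly M))"

text \<open>Lambda^i of a k x k matrix A, in the basis e_S = e_{s1} ^ ... ^ e_{si}
  (S an i-subset of {..<k}, s1 < ... < si): the (S,T) entry is the minor det A[S,T].\<close>
definition ext_pow_entry :: "complex mat \<Rightarrow> nat set \<Rightarrow> nat set \<Rightarrow> complex" where
  "ext_pow_entry A S T = det (submatrix A S T)"

definition ext_pow_basis :: "nat \<Rightarrow> nat \<Rightarrow> nat set set" where
  "ext_pow_basis k i = {S. S \<subseteq> {..<k} \<and> card S = i}"

definition conj_classes :: "('a, 'b) monoid_scheme \<Rightarrow> 'a set set" where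
  "conj_classes F = (\<lambda>x. {g \<otimes>\<^bsub>F\<^esub> x \<otimes>\<^bsub>F\<^esub> inv\<^bsub>F\<^esub> g | g. g \<in> carrier F}) ` carrier F"

definition class_functions :: "('a, 'b) monoid_scheme \<Rightarrow> ('a \<Rightarrow> complex) set" where
  "class_functions F = {h. (\<forall>x\<in>carrier F. \<forall>g\<in>carrier F. h (g \<otimes>\<^bsub>F\<^esub> x \<otimes>\<^bsub>F\<^esub> inv\<^bsub>F\<^esub> g) = h x)
                           \<and> (\<forall>x. x \<notin> carrier F \<longrightarrow> h x = 0)}"

definition class_indicator :: "'a set \<Rightarrow> 'a \<Rightarrow> complex" where
  "class_indicator C = (\<lambda>x. if x \<in> C then 1 else 0)"

text \<open>B(h) = h o phi^tors (made zero off the carrier, so that it stays in W).\<close>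
definition B_op :: "('a, 'b) monoid_scheme \<Rightarrow> ('a \<Rightarrow> 'a) \<Rightarrow> ('a \<Rightarrow> complex) \<Rightarrow> ('a \<Rightarrow> complex)" where
  "B_op F \<psi> h = (\<lambda>x. if x \<in> carrier F then h (\<psi> x) else 0)"

text \<open>Coordinate of a class function f at the basis vector 1_C: its value on C.\<close>
definition class_coord :: "'a set \<Rightarrow> ('a \<Rightarrow> complex) \<Rightarrow> complex" where
  "class_coord C f = f (SOME x. x \<in> C)"

text \<open>Trace of Lambda^i(A) (x) B on Lambda^i(C^k) (x) W, computed in the product basis
  e_S (x) 1_C: sum of the diagonal entries of the Kronecker product of the matrices.\<close>
definition trace_ext_tensor_B ::
  "nat \<Rightarrow> nat \<Rightarrow> complex mat \<Rightarrow> ('a, 'b) monoid_scheme \<Rightarrow> ('a \<Rightarrow> 'a) \<Rightarrow> complex" where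
  "trace_ext_tensor_B k i A F \<psi> =
     (\<Sum>(S, C)\<in>ext_pow_basis k i \<times> conj_classes F.
        ext_pow_entry A S S * class_coord C (B_op F \<psi> (class_indicator C)))"

end

theory Submission
  imports
    Defs
    "Jordan_Normal_Form.Column_Operations"
    "HOL-Algebra.Group_Action"
    "HOL-Algebra.Multiplicative_Group"
    "HOL-Computational_Algebra.Fundamental_Theorem_Algebra"
begin

text \<open>
  Write \<open>\<psi>\<close> for \<open>\<phi>\<close> restricted to \<open>F\<close> and \<open>A\<close> for the integer matrix of the map induced on
  \<open>\<int>\<^sup>k\<close>. Twisted conjugation by \<open>(w, g)\<close> translates the \<open>\<int>\<^sup>k\<close>-component by \<open>(1 - A) w\<close>. If
  finitely many classes exist, the lattice \<open>(1 - A) \<int>\<^sup>k\<close> has finite index, so \<open>1 - A\<close> is injective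
  and two elements over the same point of \<open>\<int>\<^sup>k\<close> can only be conjugate through \<open>w = 0\<close>. Hence
  \<open>R(\<phi>) = [\<int>\<^sup>k : (1 - A) \<int>\<^sup>k] R(\<psi>) = \<bar>det (1 - A)\<bar> R(\<psi>)\<close>, even though \<open>\<phi>\<close> need not split
  as a product. Burnside's lemma for twisted conjugation identifies \<open>R(\<psi>)\<close> with the number of
  \<open>\<psi>\<close>-invariant ordinary conjugacy classes, which is \<open>Tr B\<close>. Finally \<open>det (1 - A)\<close> is the alternating
  sum of the principal minors of \<open>A\<close>, and its sign is \<open>-1\<close> to the number of real eigenvalues
  beyond \<open>1\<close>, which has the parity of \<open>r + p\<close>.
\<close>

section \<open>The index of a full-rank sublattice\<close>

text \<open>Counting classes over a base: \<open>lift\<close> moves any element, within its class,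
  over a chosen point of its base class, and \<open>fibre\<close> says that over one fixed point
  only \<open>T\<close> remains. The count serves twice, for splitting off a coordinate of a lattice
  and for projecting \<int>^k \<times> F to \<int>^k.\<close>

lemma card_quotient_fibration:
  assumes R: "equiv X R" and S: "equiv Y S" and T: "equiv Z T" and f: "bij_betw f X (Y \<times> Z)"
    and base: "\<And>x x'. (x, x') \<in> R \<Longrightarrow> (fst (f x), fst (f x')) \<in> S"
    and lift: "\<And>x y. x \<in> X \<Longrightarrow> (fst (f x), y) \<in> S \<Longrightarrow> \<exists>x'. (x, x') \<in> R \<and> fst (f x') = y"
    and fibre: "\<And>x x'. x \<in> X \<Longrightarrow> x' \<in> X \<Longrightarrow> fst (f x) = fst (f x') \<Longrightarrow>
      (x, x') \<in> R \<longleftrightarrow> (snd (f x), snd (f x')) \<in> T"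
  shows "card (X // R) = card (Y // S) * card (Z // T)"
proof -
  \<comment> \<open>Fibre coordinates can be compared only over equal base points, so a
    representative \<open>y C\<close> of each base class is fixed once and for all, and
    \<open>h\<close> places every fibre class over it.\<close>
  define y where "y C = (SOME a. a \<in> C)" for C :: "'b set"
  define z where "z C = (SOME a. a \<in> C)" for C :: "'c set"
  define h where "h = (\<lambda>(C, D). R `` {inv_into X f (y C, z D)})"
  have y: "y C \<in> C" "y C \<in> Y" "C = S `` {y C}" if "C \<in> Y // S" for C
  proof -
    from that obtain a where a: "a \<in> Y" "C = S `` {a}" by (rule quotientE)
    then have "a \<in> C" using equiv_class_self[OF S] by auto
    then show *: "y C \<in> C" unfolding y_def by (rule someI)
    then have "(a, y C) \<in> S" using a by auto
    then show "y C \<in> Y" "C = S `` {y C}" using a unfolding equiv_class_eq_iff[OF S] by auto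
  qed
  have z: "z C \<in> C" "z C \<in> Z" "C = T `` {z C}" if "C \<in> Z // T" for C
  proof -
    from that obtain a where a: "a \<in> Z" "C = T `` {a}" by (rule quotientE)
    then have "a \<in> C" using equiv_class_self[OF T] by auto
    then show *: "z C \<in> C" unfolding z_def by (rule someI)
    then have "(a, z C) \<in> T" using a by auto
    then show "z C \<in> Z" "C = T `` {z C}" using a unfolding equiv_class_eq_iff[OF T] by auto
  qed
  have g: "inv_into X f p \<in> X" "f (inv_into X f p) = p" if "p \<in> Y \<times> Z" for p
    using that f by (auto simp: bij_betw_def inv_into_into f_inv_into_f)
  have "bij_betw h ((Y // S) \<times> (Z // T)) (X // R)"
  proof (rule bij_betwI')
    fix p q assume p: "p \<in> (Y // S) \<times> (Z // T)" and q: "q \<in> (Y // S) \<times> (Z // T)"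
    show "(h p = h q) = (p = q)"
    proof
      assume eq: "h p = h q"
      obtain C D C' D' where pq: "p = (C, D)" "q = (C', D')" by (cases p, cases q)
      let ?a = "inv_into X f (y C, z D)" and ?b = "inv_into X f (y C', z D')"
      have ab: "?a \<in> X" "?b \<in> X" "f ?a = (y C, z D)" "f ?b = (y C', z D')"
        using p q pq y z g by auto
      have rel: "(?a, ?b) \<in> R"
        using eq pq ab eq_equiv_class[OF _ R] by (auto simp: h_def)
      have "(y C, y C') \<in> S" using base[OF rel] ab by simp
      then have "S `` {y C} = S `` {y C'}" by (rule equiv_class_eq[OF S])
      moreover have "C = S `` {y C}" "C' = S `` {y C'}" using y(3) p q pq by blast+
      ultimately have C: "C = C'" by metis
      then have "(z D, z D') \<in> T" using fibre[of ?a ?b] rel ab by simp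
      then have "T `` {z D} = T `` {z D'}" by (rule equiv_class_eq[OF T])
      moreover have "D = T `` {z D}" "D' = T `` {z D'}" using z(3) p q pq by blast+
      ultimately have "D = D'" by metis
      with C pq show "p = q" by simp
    qed simp
  next
    fix p assume "p \<in> (Y // S) \<times> (Z // T)"
    then show "h p \<in> X // R" using g y z by (auto simp: h_def quotientI)
  next
    fix E assume "E \<in> X // R"
    then obtain x where x: "x \<in> X" "E = R `` {x}" by (rule quotientE)
    have fx: "fst (f x) \<in> Y" "snd (f x) \<in> Z" using bij_betwE[OF f] x(1) by (auto simp: mem_Times_iff)
    let ?C = "S `` {fst (f x)}"
    have C: "?C \<in> Y // S" using fx by (simp add: quotientI)
    have "(fst (f x), y ?C) \<in> S" using y[OF C] by auto
    \<comment> \<open>Surjectivity: slide \<open>x\<close> within its class over the chosen base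
      point, then read off the fibre class there.\<close>
    then obtain x' where x': "(x, x') \<in> R" "fst (f x') = y ?C" using lift[OF x(1)] by blast
    have x'X: "x' \<in> X" using x' R equiv_type by fastforce
    have fx': "snd (f x') \<in> Z" using bij_betwE[OF f] x'X by (auto simp: mem_Times_iff)
    let ?D = "T `` {snd (f x')}"
    have D: "?D \<in> Z // T" using fx' by (simp add: quotientI)
    let ?a = "inv_into X f (y ?C, z ?D)"
    have a: "?a \<in> X" "f ?a = (y ?C, z ?D)" using g y z C D by auto
    have "(x', ?a) \<in> R" using fibre[OF x'X a(1)] a x' z[OF D] by auto
    then have "R `` {?a} = E" 
      using equiv_class_eq[OF R \<open>(x', ?a) \<in> R\<close>] equiv_class_eq[OF R x'(1)] x(2) by (simp only:)
    then have "E = h (?C, ?D)" unfolding h_def by simp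
    then show "\<exists>p\<in>(Y // S) \<times> (Z // T). E = h p" using C D by blast
  qed
  from bij_betw_same_card[OF this] show ?thesis by (simp add: card_cartesian_product)
qed

section \<open>Cosets of the column lattice of an integer matrix\<close>

text \<open>Congruence modulo the lattice A \<int>^n. As a relation on vectors it makes the quotient
  group a plain set of classes, whose cardinality is the index.\<close>

definition lattice_rel :: "nat \<Rightarrow> int mat \<Rightarrow> (int vec \<times> int vec) set" where
  "lattice_rel n A = {(v, w). v \<in> carrier_vec n \<and> w \<in> carrier_vec n \<and>
     (\<exists>u\<in>carrier_vec n. w = v + A *\<^sub>v u)}"

lemma equiv_lattice_rel:
  assumes A: "A \<in> carrier_mat n n"
  shows "equiv (carrier_vec n) (lattice_rel n A)"
proof (rule equivI)
  show "refl_on (carrier_vec n) (lattice_rel n A)"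
    using A by (auto simp: refl_on_def lattice_rel_def intro!: bexI[of _ "0\<^sub>v n"])
  show "sym (lattice_rel n A)"
  proof (rule symI)
    fix v w assume "(v, w) \<in> lattice_rel n A"
    then obtain u where u: "v \<in> carrier_vec n" "w \<in> carrier_vec n" "u \<in> carrier_vec n" "w = v + A *\<^sub>v u"
      by (auto simp: lattice_rel_def)
    have "A *\<^sub>v (- u) = - (A *\<^sub>v u)" using A u by (intro eq_vecI) auto
    then have "v = w + A *\<^sub>v (- u)" using A u by (intro eq_vecI) auto
    then show "(w, v) \<in> lattice_rel n A" using u by (auto simp: lattice_rel_def intro!: bexI[of _ "- u"])
  qed
  show "trans (lattice_rel n A)"
  proof (rule transI)
    fix x y z assume "(x, y) \<in> lattice_rel n A" "(y, z) \<in> lattice_rel n A"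
    then obtain u u' where u: "x \<in> carrier_vec n" "u \<in> carrier_vec n" "y = x + A *\<^sub>v u"
        "u' \<in> carrier_vec n" "z = y + A *\<^sub>v u'" "z \<in> carrier_vec n"
      by (auto simp: lattice_rel_def)
    have "z = x + A *\<^sub>v (u + u')" using A u 
      by (subst mult_add_distrib_mat_vec[OF A u(2,4)]) (auto intro!: eq_vecI)
    then show "(x, z) \<in> lattice_rel n A" using u by (auto simp: lattice_rel_def intro!: bexI[of _ "u + u'"])
  qed
qed (auto simp: lattice_rel_def)

text \<open>A vector (A P) u is A applied to P u. Column operations are right multiplications, so
  using this for an operation and for its inverse shows that the lattice does not change.\<close>

lemma lattice_rel_mult_subset:
  assumes A: "A \<in> carrier_mat n n" and P: "P \<in> carrier_mat n n"
  shows "lattice_rel n (A * P) \<subseteq> lattice_rel n A"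
proof clarify
  fix v w assume "(v, w) \<in> lattice_rel n (A * P)"
  then obtain u where u: "v \<in> carrier_vec n" "w \<in> carrier_vec n" "u \<in> carrier_vec n" "w = v + (A * P) *\<^sub>v u"
    by (auto simp: lattice_rel_def)
  have "(A * P) *\<^sub>v u = A *\<^sub>v (P *\<^sub>v u)" using A P u(3) by (rule assoc_mult_mat_vec)
  then show "(v, w) \<in> lattice_rel n A"
    using u P by (auto simp: lattice_rel_def intro!: bexI[of _ "P *\<^sub>v u"])
qed

text \<open>The operation is undone by adding the opposite multiple, so the inclusion holds in both
  directions.\<close>

lemma lattice_rel_addcol:
  assumes A: "A \<in> carrier_mat n n" and l: "l < n" and kl: "k \<noteq> l"
  shows "lattice_rel n (addcol a k l A) = lattice_rel n A"
proof -
  have sub: "lattice_rel n (addcol b k l B) \<subseteq> lattice_rel n B" if B: "B \<in> carrier_mat n n" for b B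
    unfolding addcol_mat[OF B l] by (rule lattice_rel_mult_subset[OF B]) simp
  have "addcol (- a) k l (addcol a k l A) = A" using A l kl by (intro eq_matI) auto
  moreover have "addcol a k l A \<in> carrier_mat n n" using A by (intro carrier_matI) auto
  ultimately show ?thesis using sub[of A a] sub[of "addcol a k l A" "- a"] A by auto
qed

lemma lattice_rel_swapcols:
  assumes A: "A \<in> carrier_mat n n" and k: "k < n" and l: "l < n"
  shows "lattice_rel n (swapcols k l A) = lattice_rel n A"
proof -
  have sub: "lattice_rel n (swapcols k l B) \<subseteq> lattice_rel n B" if B: "B \<in> carrier_mat n n" for B
    unfolding swapcols_mat[OF B k l] by (rule lattice_rel_mult_subset[OF B]) simp
  have "swapcols k l (swapcols k l A) = A" using A k l by (intro eq_matI) auto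
  with sub[of A] sub[of "swapcols k l A"] A show ?thesis by auto
qed

section \<open>Congruence modulo an integer, and the index by column reduction\<close>

definition dvd_rel :: "int \<Rightarrow> (int \<times> int) set" where
  "dvd_rel d = {(a, b). d dvd b - a}"

lemma equiv_dvd_rel: "equiv UNIV (dvd_rel d)"
proof (rule equivI)
  show "sym (dvd_rel d)" by (auto simp: dvd_rel_def intro!: symI dest: dvd_diff_commute[THEN iffD1])
  show "trans (dvd_rel d)"
  proof (rule transI)
    fix a b c assume "(a, b) \<in> dvd_rel d" "(b, c) \<in> dvd_rel d"
    then have "d dvd (b - a) + (c - b)" unfolding dvd_rel_def by (blast intro: dvd_add)
    then show "(a, c) \<in> dvd_rel d" by (simp add: dvd_rel_def)
  qed
qed (auto simp: dvd_rel_def refl_on_def)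

lemma card_quotient_dvd_rel:
  assumes "d \<noteq> 0"
  shows "card (UNIV // dvd_rel d) = nat \<bar>d\<bar>"
proof -
  have iff: "(a, b) \<in> dvd_rel d \<longleftrightarrow> a mod \<bar>d\<bar> = b mod \<bar>d\<bar>" for a b
    by (simp add: dvd_rel_def mod_eq_dvd_iff dvd_diff_commute)
  have "bij_betw (\<lambda>a. dvd_rel d `` {a}) {0..<\<bar>d\<bar>} (UNIV // dvd_rel d)"
  proof (rule bij_betwI')
    fix a b assume "a \<in> {0..<\<bar>d\<bar>}" "b \<in> {0..<\<bar>d\<bar>}"
    then show "(dvd_rel d `` {a} = dvd_rel d `` {b}) = (a = b)"
      using eq_equiv_class_iff[OF equiv_dvd_rel, of a b d] by (simp add: iff)
  next
    fix E assume "E \<in> UNIV // dvd_rel d"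
    then obtain a where a: "E = dvd_rel d `` {a}" by (rule quotientE)
    have "(a, a mod \<bar>d\<bar>) \<in> dvd_rel d" by (simp add: iff)
    then have "E = dvd_rel d `` {a mod \<bar>d\<bar>}" unfolding a by (rule equiv_class_eq[OF equiv_dvd_rel])
    then show "\<exists>b\<in>{0..<\<bar>d\<bar>}. E = dvd_rel d `` {b}" using assms by (intro bexI[of _ "a mod \<bar>d\<bar>"]) auto
  qed (simp add: quotientI)
  from bij_betw_same_card[OF this] show ?thesis by simp
qed

text \<open>With first row (d, 0, ..., 0) the matrix is block triangular. For d \<noteq> 0,
  projection to the first coordinate fibres the quotient over \<int>/d, with fibre the quotient by
  the remaining block \<open>C\<close>; the determinant factors in the same way. The induction
  hypothesis is passed in as the premise \<open>IH\<close>.\<close>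

lemma lattice_index_block:
  fixes A :: "int mat"
  assumes A: "A \<in> carrier_mat (Suc n) (Suc n)"
    and row: "\<And>j. 0 < j \<Longrightarrow> j < Suc n \<Longrightarrow> A $$ (0, j) = 0"
    and IH: "\<And>C. C \<in> carrier_mat n n \<Longrightarrow> card (carrier_vec n // lattice_rel n C) = nat \<bar>det C\<bar>"
  shows "card (carrier_vec (Suc n) // lattice_rel (Suc n) A) = nat \<bar>det A\<bar>"
proof -
  define d where "d = A $$ (0, 0)"
  define C where "C = mat_delete A 0 0"
  define tl where "tl v = vec n (\<lambda>i. v $ Suc i)" for v :: "int vec"
  have C: "C \<in> carrier_mat n n" using mat_delete_carrier[OF A, of 0 0] by (simp add: C_def)
  have C_index: "C $$ (i, j) = A $$ (Suc i, Suc j)" if "i < n" "j < n" for i j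
    using that A by (simp add: C_def mat_delete_def)
  have det: "det A = d * det C"
  proof -
    have "det A = (\<Sum>j<Suc n. A $$ (0, j) * cofactor A 0 j)"
      by (rule laplace_expansion_row[OF A]) simp
    also have "\<dots> = d * cofactor A 0 0"
      unfolding sum.lessThan_Suc_shift using row by (simp add: d_def)
    finally show ?thesis by (simp add: cofactor_def C_def)
  qed
  have mult0: "(A *\<^sub>v u) $ 0 = d * u $ 0" if "u \<in> carrier_vec (Suc n)" for u
    using that A row by (simp add: scalar_prod_def d_def sum.atLeast0_lessThan_Suc_shift del: sum.op_ivl_Suc)
  have multS: "(A *\<^sub>v u) $ Suc i = A $$ (Suc i, 0) * u $ 0 + (C *\<^sub>v tl u) $ i"
    if "u \<in> carrier_vec (Suc n)" "i < n" for u i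
    using that A C
    by (simp add: scalar_prod_def C_index tl_def sum.atLeast0_lessThan_Suc_shift del: sum.op_ivl_Suc)
  have vec_eq: "v = w \<longleftrightarrow> v $ 0 = w $ 0 \<and> tl v = tl w"
    if "v \<in> carrier_vec (Suc n)" "w \<in> carrier_vec (Suc n)" for v w
  proof
    assume *: "v $ 0 = w $ 0 \<and> tl v = tl w"
    have "v $ i = w $ i" if "i < Suc n" for i
    proof (cases i)
      case (Suc j)
      then have "tl v $ j = tl w $ j" using * by simp
      then show ?thesis using Suc that by (simp add: tl_def)
    qed (use * in simp)
    then show "v = w" using that by auto
  qed auto
  have tl_carrier: "tl v \<in> carrier_vec n" for v by (simp add: tl_def)
  define cons where "cons a v = vec (Suc n) (\<lambda>i. case i of 0 \<Rightarrow> a | Suc j \<Rightarrow> v $ j)" for a and v :: "int vec"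
  have cons: "cons a v \<in> carrier_vec (Suc n)" "cons a v $ 0 = a" for a v
    by (simp_all add: cons_def)
  have tl_cons: "tl (cons a v) = v" if "v \<in> carrier_vec n" for a v
    using that by (auto simp: tl_def cons_def)
  show ?thesis
  proof (cases "d = 0")
    case True
    \<comment> \<open>For d = 0 the lattice lies in the hyperplane of vectors with first coordinate
      0, so distinct first coordinates give distinct cosets. The quotient is infinite, and its
      \<open>card\<close> is 0, like the determinant.\<close>
    have "inj (\<lambda>a. lattice_rel (Suc n) A `` {cons a (0\<^sub>v n)})"
    proof (rule injI)
      fix a b
      assume "lattice_rel (Suc n) A `` {cons a (0\<^sub>v n)} = lattice_rel (Suc n) A `` {cons b (0\<^sub>v n)}"
      then have "(cons a (0\<^sub>v n), cons b (0\<^sub>v n)) \<in> lattice_rel (Suc n) A"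
        by (rule eq_equiv_class[OF _ equiv_lattice_rel[OF A] cons(1)])
      then obtain u where u: "u \<in> carrier_vec (Suc n)" "cons b (0\<^sub>v n) = cons a (0\<^sub>v n) + A *\<^sub>v u"
        by (auto simp: lattice_rel_def)
      then have "cons b (0\<^sub>v n) $ 0 = cons a (0\<^sub>v n) $ 0 + (A *\<^sub>v u) $ 0"
        using A by (simp del: index_mult_mat_vec)
      then show "a = b" using mult0[OF u(1)] True cons by simp
    qed
    then have "infinite (range (\<lambda>a. lattice_rel (Suc n) A `` {cons a (0\<^sub>v n)}))"
      using finite_imageD infinite_UNIV_int by blast
    then have "infinite (carrier_vec (Suc n) // lattice_rel (Suc n) A)"
      by (rule contrapos_nn) (auto elim!: rev_finite_subset intro!: quotientI cons)
    then show ?thesis using True det by simp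
  next
    case False
    have "card (carrier_vec (Suc n) // lattice_rel (Suc n) A)
        = card (UNIV // dvd_rel d) * card (carrier_vec n // lattice_rel n C)"
    proof (rule card_quotient_fibration[OF equiv_lattice_rel[OF A] equiv_dvd_rel equiv_lattice_rel[OF C],
          where f = "\<lambda>v. (v $ 0, tl v)"])
      show "bij_betw (\<lambda>v. (v $ 0, tl v)) (carrier_vec (Suc n)) (UNIV \<times> carrier_vec n)"
        by (rule bij_betw_byWitness[where f' = "\<lambda>(a, v). cons a v"])
           (auto simp: tl_cons cons vec_eq tl_carrier)
    next
      fix v w assume "(v, w) \<in> lattice_rel (Suc n) A"
      then obtain u where u: "v \<in> carrier_vec (Suc n)" "u \<in> carrier_vec (Suc n)" "w = v + A *\<^sub>v u"
        by (auto simp: lattice_rel_def)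
      then have "w $ 0 = v $ 0 + d * u $ 0" using A mult0 by (simp del: index_mult_mat_vec)
      then show "(fst (v $ 0, tl v), fst (w $ 0, tl w)) \<in> dvd_rel d" by (simp add: dvd_rel_def)
    next
      fix v y assume v: "v \<in> carrier_vec (Suc n)" and "(fst (v $ 0, tl v), y) \<in> dvd_rel d"
      then obtain t where t: "y = v $ 0 + d * t" by (auto simp: dvd_rel_def dvd_def algebra_simps)
      \<comment> \<open>Adding the first column \<open>t\<close> times shifts the first coordinate
        by d t; what it does to the others is irrelevant for \<open>lift\<close>.\<close>
      let ?u = "cons t (0\<^sub>v n)"
      have "(v, v + A *\<^sub>v ?u) \<in> lattice_rel (Suc n) A"
        using v A cons by (auto simp: lattice_rel_def intro!: bexI[of _ ?u])
      moreover have "(v + A *\<^sub>v ?u) $ 0 = y"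
        using v A mult0[of ?u] cons t by (simp del: index_mult_mat_vec)
      ultimately show "\<exists>x'. (v, x') \<in> lattice_rel (Suc n) A \<and> fst (x' $ 0, tl x') = y" by auto
    next
      fix v w assume vw: "v \<in> carrier_vec (Suc n)" "w \<in> carrier_vec (Suc n)"
        "fst (v $ 0, tl v) = fst (w $ 0, tl w)"
      \<comment> \<open>If the first coordinate of \<open>u\<close> vanishes, the first column of
        \<open>A\<close> does not enter and \<open>A\<close> acts on the tail as
        \<open>C\<close>.\<close>
      have *: "w = v + A *\<^sub>v u \<longleftrightarrow> tl w = tl v + C *\<^sub>v tl u"
        if "u \<in> carrier_vec (Suc n)" "u $ 0 = 0" for u
      proof -
        have "tl (v + A *\<^sub>v u) = tl v + C *\<^sub>v tl u"
          using that vw A C multS[OF that(1)] by (intro eq_vecI) (auto simp: tl_def simp del: index_mult_mat_vec)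
        moreover have "(v + A *\<^sub>v u) $ 0 = w $ 0"
          using vw A mult0[OF that(1)] that by (simp del: index_mult_mat_vec)
        moreover have "v + A *\<^sub>v u \<in> carrier_vec (Suc n)"
          using vw(1) mult_mat_vec_carrier[OF A that(1)] by simp
        ultimately show ?thesis using vec_eq[OF vw(2)] by auto
      qed
      show "((v, w) \<in> lattice_rel (Suc n) A) = ((snd (v $ 0, tl v), snd (w $ 0, tl w)) \<in> lattice_rel n C)"
      proof
        assume "(v, w) \<in> lattice_rel (Suc n) A"
        then obtain u where u: "u \<in> carrier_vec (Suc n)" "w = v + A *\<^sub>v u"
          by (auto simp: lattice_rel_def)
        then have "w $ 0 = v $ 0 + d * u $ 0" using A vw mult0 by (simp del: index_mult_mat_vec)
        \<comment> \<open>Here d \<noteq> 0 is essential: equal first coordinates leave only lattice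
          vectors coming from \<open>C\<close>.\<close>
        then have "u $ 0 = 0" using False vw by simp
        then show "(snd (v $ 0, tl v), snd (w $ 0, tl w)) \<in> lattice_rel n C"
          using *[OF u(1)] u(2) tl_carrier unfolding lattice_rel_def
          by (intro CollectI) (simp only: prod.case snd_conv, blast)
      next
        assume "(snd (v $ 0, tl v), snd (w $ 0, tl w)) \<in> lattice_rel n C"
        then obtain u where u: "u \<in> carrier_vec n" "tl w = tl v + C *\<^sub>v u" by (auto simp: lattice_rel_def)
        then have "w = v + A *\<^sub>v cons 0 u" using *[of "cons 0 u"] by (simp add: cons tl_cons)
        then show "(v, w) \<in> lattice_rel (Suc n) A"
          using vw cons by (auto simp: lattice_rel_def intro!: bexI[of _ "cons 0 u"])
      qed
    qed
    then show ?thesis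
      by (simp add: det IH[OF C] card_quotient_dvd_rel[OF False] abs_mult nat_mult_distrib)
  qed
qed

text \<open>An infinite quotient has cardinality 0, matching \<open>det A = 0\<close>.\<close>
lemma lattice_index_eq_abs_det:
  assumes "A \<in> carrier_mat n n"
  shows "card (carrier_vec n // lattice_rel n A) = nat \<bar>det A\<bar>"
  using assms
proof (induction n arbitrary: A)
  case 0
  have "carrier_vec 0 = {0\<^sub>v 0 :: int vec}" by auto
  then have "card (carrier_vec 0 // lattice_rel 0 A) = 1" by (simp add: singleton_quotient)
  then show ?case using 0 by simp
next
  case (Suc n)
  show ?case using Suc.prems
  \<comment> \<open>Inner induction on the absolute sum of the first row: column operations shrink
    it until at most one entry is nonzero.\<close>
  proof (induction "\<Sum>j<Suc n. nat \<bar>A $$ (0, j)\<bar>" arbitrary: A rule: less_induct)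
    case less
    note A = less.prems
    show ?case
    proof (cases "\<exists>j l. j < Suc n \<and> l < Suc n \<and> j \<noteq> l \<and> A $$ (0, j) \<noteq> 0 \<and> A $$ (0, l) \<noteq> 0")
      case True
      then obtain j l where jl: "j < Suc n" "l < Suc n" "j \<noteq> l" "A $$ (0, j) \<noteq> 0" "A $$ (0, l) \<noteq> 0"
        and le: "\<bar>A $$ (0, l)\<bar> \<le> \<bar>A $$ (0, j)\<bar>"
        by (metis nle_le)
      \<comment> \<open>A Euclidean step on the first row, decreasing the sum of its absolute values.\<close>
      let ?c = "- (sgn (A $$ (0, j)) * sgn (A $$ (0, l)))"
      let ?B = "addcol ?c j l A"
      have B: "?B \<in> carrier_mat (Suc n) (Suc n)" using A by (intro carrier_matI) auto
      have "\<bar>?c * A $$ (0, l) + A $$ (0, j)\<bar> < \<bar>A $$ (0, j)\<bar>"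
        using jl(4,5) le by (auto simp: sgn_if abs_if split: if_splits)
      then have "(\<Sum>i<Suc n. nat \<bar>?B $$ (0, i)\<bar>) < (\<Sum>i<Suc n. nat \<bar>A $$ (0, i)\<bar>)"
        using jl A by (intro sum_strict_mono_ex1) (auto intro!: bexI[of _ j])
      from less.hyps[OF this B] show ?thesis
        using lattice_rel_addcol[OF A jl(2,3)] det_addcol[OF jl(2,3) A] by simp
    next
      case False
      \<comment> \<open>\<open>l\<close> is the position of the only nonzero entry, or an arbitrary
        column if the row is zero.\<close>
      then obtain l where l: "l < Suc n" "\<And>j. j < Suc n \<Longrightarrow> j \<noteq> l \<Longrightarrow> A $$ (0, j) = 0"
        by blast
      show ?thesis
      proof (cases "l = 0")
        case True
        then show ?thesis using lattice_index_block[OF A _ Suc.IH] l by auto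
      next
        case False
        \<comment> \<open>A swap brings the entry to the front and changes only the sign of the
          determinant.\<close>
        let ?B = "swapcols 0 l A"
        have B: "?B \<in> carrier_mat (Suc n) (Suc n)" using A by simp
        have "?B $$ (0, j) = 0" if "0 < j" "j < Suc n" for j
          using that A l False by (cases "j = l") auto
        from lattice_index_block[OF B this Suc.IH] show ?thesis
          using lattice_rel_swapcols[OF A _ l(1), of 0] det_swapcols[OF _ l(1) _ A, of 0] False by simp
      qed
    qed
  qed
qed

section \<open>Principal minors\<close>

text \<open>\<open>pick S\<close> is strictly increasing below \<open>card S\<close>, so it is the
  enumeration by which \<open>submatrix\<close> numbers its rows and columns.\<close>

lemma bij_betw_pick:
  assumes "finite S"
  shows "bij_betw (pick S) {..<card S} S"
proof -
  have inj: "inj_on (pick S) {..<card S}"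
    by (intro linorder_inj_onI) (auto dest: pick_mono_le)
  moreover have "pick S ` {..<card S} = S"
    by (rule card_subset_eq[OF assms]) (use inj in \<open>auto simp: pick_in_set_le card_image\<close>)
  ultimately show ?thesis by (simp add: bij_betw_def)
qed

text \<open>Leibniz formula for the minor, with its permutations transported along the enumeration
  \<open>pick S\<close> to permutations of \<open>S\<close> itself; the transport preserves signs.
  Minors for different \<open>S\<close> thereby use the original indices.\<close>

lemma det_principal_submatrix:
  fixes A :: "'a :: comm_ring_1 mat"
  assumes A: "A \<in> carrier_mat n n" and S: "S \<subseteq> {0..<n}"
  shows "det (submatrix A S S) = (\<Sum>p | p permutes S. signof p * (\<Prod>i\<in>S. A $$ (i, p i)))"
proof -
  let ?c = "card S" and ?f = "pick S"
  have fin: "finite S" using S finite_subset by blast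
  have f: "bij_betw ?f {0..<?c} S" using bij_betw_pick[OF fin] by (simp add: atLeast0LessThan)
  then have inj: "inj_on ?f {0..<?c}" by (simp add: bij_betw_def)
  have eq: "{i. i < n \<and> i \<in> S} = S" using S by auto
  have sub: "submatrix A S S = mat ?c ?c (\<lambda>(i, j). A $$ (?f i, ?f j))"
    using A eq by (simp add: submatrix_def)
  have bij: "bij_betw (map_permutation {0..<?c} ?f) {p. p permutes {0..<?c}} {p. p permutes S}"
  proof (rule bij_betw_byWitness[where f' = "map_permutation S (inv_into {0..<?c} ?f)"])
    have f': "bij_betw (inv_into {0..<?c} ?f) S {0..<?c}" by (rule bij_betw_inv_into[OF f])
    show "\<forall>p\<in>{p. p permutes {0..<?c}}.
        map_permutation S (inv_into {0..<?c} ?f) (map_permutation {0..<?c} ?f p) = p"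
      using inj f by (auto intro!: map_permutation_compose_inv simp: bij_betw_def inv_into_f_f)
    show "\<forall>p\<in>{p. p permutes S}.
        map_permutation {0..<?c} ?f (map_permutation S (inv_into {0..<?c} ?f) p) = p"
      using f f' by (auto intro!: map_permutation_compose_inv simp: bij_betw_def f_inv_into_f)
    show "map_permutation {0..<?c} ?f ` {p. p permutes {0..<?c}} \<subseteq> {p. p permutes S}"
      using map_permutation_permutes[OF f] by auto
    show "map_permutation S (inv_into {0..<?c} ?f) ` {p. p permutes S} \<subseteq> {p. p permutes {0..<?c}}"
      using map_permutation_permutes[OF f'] by auto
  qed
  have "det (submatrix A S S) = (\<Sum>p | p permutes {0..<?c}. signof p * (\<Prod>i = 0..<?c. A $$ (?f i, ?f (p i))))"
    unfolding sub det_def'[OF mat_carrier]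
    by (intro sum.cong refl arg_cong2[of _ _ _ _ "(*)"] prod.cong)
       (auto dest: permutes_in_image)
  also have "\<dots> = (\<Sum>p | p permutes {0..<?c}. signof (map_permutation {0..<?c} ?f p) *
      (\<Prod>i\<in>S. A $$ (i, map_permutation {0..<?c} ?f p i)))"
  proof (intro sum.cong refl)
    fix p assume "p \<in> {p. p permutes {0..<?c}}"
    then have p: "p permutes {0..<?c}" by simp
    have "(\<Prod>i\<in>S. A $$ (i, map_permutation {0..<?c} ?f p i))
        = (\<Prod>i = 0..<?c. A $$ (?f i, map_permutation {0..<?c} ?f p (?f i)))"
      by (rule prod.reindex_bij_betw[OF f, symmetric])
    also have "\<dots> = (\<Prod>i = 0..<?c. A $$ (?f i, ?f (p i)))"
      by (intro prod.cong refl) (simp add: map_permutation_apply[OF inj])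
    finally show "signof p * (\<Prod>i = 0..<?c. A $$ (?f i, ?f (p i))) =
        signof (map_permutation {0..<?c} ?f p) * (\<Prod>i\<in>S. A $$ (i, map_permutation {0..<?c} ?f p i))"
      by (simp add: sign_map_permutation[OF inj p])
  qed
  also have "\<dots> = (\<Sum>p | p permutes S. signof p * (\<Prod>i\<in>S. A $$ (i, p i)))"
    by (rule sum.reindex_bij_betw[OF bij])
  finally show ?thesis .
qed

text \<open>In the Leibniz sum, multiply out the factors \<delta> - a. If -a is chosen on
  \<open>S\<close>, the deltas on the complement kill every permutation that moves a point outside
  \<open>S\<close>, and the permutations of \<open>S\<close> that survive add up to its principal
  minor.\<close>

lemma det_one_minus_eq_sum_principal_minors:
  fixes A :: "'a :: comm_ring_1 mat"
  assumes A: "A \<in> carrier_mat n n"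
  shows "det (1\<^sub>m n - A) = (\<Sum>S\<in>Pow {0..<n}. (-1) ^ card S * det (submatrix A S S))"
proof -
  let ?N = "{0..<n}"
  let ?d = "\<lambda>p i. if p i = i then 1 else (0 :: 'a)"
  have IA: "1\<^sub>m n - A \<in> carrier_mat n n" by (rule minus_carrier_mat[OF A])
  have inner: "(\<Sum>p | p permutes ?N. signof p * ((\<Prod>i\<in>S. A $$ (i, p i)) * (\<Prod>i\<in>?N - S. ?d p i)))
      = det (submatrix A S S)" if S: "S \<subseteq> ?N" for S
  proof -
    have "(\<Sum>p | p permutes ?N. signof p * ((\<Prod>i\<in>S. A $$ (i, p i)) * (\<Prod>i\<in>?N - S. ?d p i)))
        = (\<Sum>p | p permutes S. signof p * ((\<Prod>i\<in>S. A $$ (i, p i)) * (\<Prod>i\<in>?N - S. ?d p i)))"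
    proof (rule sum.mono_neutral_right)
      show "{p. p permutes S} \<subseteq> {p. p permutes ?N}" using S permutes_subset by blast
      show "\<forall>p\<in>{p. p permutes ?N} - {p. p permutes S}.
          signof p * ((\<Prod>i\<in>S. A $$ (i, p i)) * (\<Prod>i\<in>?N - S. ?d p i)) = 0"
      proof
        fix p assume p: "p \<in> {p. p permutes ?N} - {p. p permutes S}"
        have "\<exists>i\<in>?N - S. p i \<noteq> i"
        proof (rule ccontr)
          assume "\<not> (\<exists>i\<in>?N - S. p i \<noteq> i)"
          then have "p permutes S" using p permutes_superset[of p ?N S] by auto
          with p show False by simp
        qed
        then have "(\<Prod>i\<in>?N - S. ?d p i) = 0" by (intro prod_zero) auto
        then show "signof p * ((\<Prod>i\<in>S. A $$ (i, p i)) * (\<Prod>i\<in>?N - S. ?d p i)) = 0" by simp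
      qed
    qed (simp add: finite_permutations)
    also have "\<dots> = (\<Sum>p | p permutes S. signof p * (\<Prod>i\<in>S. A $$ (i, p i)))"
      by (intro sum.cong refl) (auto simp: permutes_not_in)
    finally show ?thesis by (simp add: det_principal_submatrix[OF A S])
  qed
  have "det (1\<^sub>m n - A) = (\<Sum>p | p permutes ?N. signof p * (\<Prod>i\<in>?N. ?d p i - A $$ (i, p i)))"
    unfolding det_def'[OF IA] using A
    by (intro sum.cong refl arg_cong2[of _ _ _ _ "(*)"] prod.cong)
       (auto dest: permutes_in_image)
  \<comment> \<open>\<open>S\<close> collects the rows in which the matrix entry is chosen, each
    with a minus sign.\<close>
  also have "\<dots> = (\<Sum>p | p permutes ?N. \<Sum>S\<in>Pow ?N. (-1) ^ card S *
      (signof p * ((\<Prod>i\<in>S. A $$ (i, p i)) * (\<Prod>i\<in>?N - S. ?d p i))))"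
    by (simp add: prod_diff_conv_sum sum_distrib_left mult_ac)
  also have "\<dots> = (\<Sum>S\<in>Pow ?N. (-1) ^ card S * 
     (\<Sum>p | p permutes ?N. signof p * ((\<Prod>i\<in>S. A $$ (i, p i)) * (\<Prod>i\<in>?N - S. ?d p i))))"
    by (subst sum.swap) (simp add: sum_distrib_left)
  also have "\<dots> = (\<Sum>S\<in>Pow ?N. (-1) ^ card S * det (submatrix A S S))"
    by (intro sum.cong refl) (simp add: inner)
  finally show ?thesis .
qed

section \<open>The sign of the characteristic polynomial at 1\<close>

text \<open>Conjugation is a field automorphism, so it carries the order at z of a polynomial to the
  order at the conjugate of z of its image, here the same polynomial because its coefficients are
  real.\<close>

lemma order_cnj:
  assumes "map_poly cnj p = p"
  shows "Polynomial.order (cnj z) p = Polynomial.order z p"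
proof -
  have "map_poly_inj_idom_divide_hom cnj"
    by unfold_locales auto
  from map_poly_inj_idom_divide_hom.order_hom[OF this, of z p] show ?thesis
    using assms by simp
qed

text \<open>Evaluate the factorisation into linear factors at 1. The positive real \<open>t\<close>
  expresses that a complex number is real and has the given sign; orders account for multiple
  roots.\<close>

lemma poly_one_sign:
  fixes p :: "complex poly"
  assumes p: "lead_coeff p = 1" "map_poly cnj p = p" and nz: "poly p 1 \<noteq> 0"
  shows "\<exists>t>0. poly p 1 = (-1) ^ (\<Sum>\<mu> | poly p \<mu> = 0 \<and> \<mu> \<in> \<real> \<and> Re \<mu> > 1. Polynomial.order \<mu> p) * complex_of_real t"
proof -
  have p0: "p \<noteq> 0" using p(1) by auto
  define g where "g = (\<lambda>\<mu>. (1 - \<mu>) ^ Polynomial.order \<mu> p)"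
  define Z where "Z = {\<mu>. poly p \<mu> = 0}"
  define U L H I where "U = {\<mu>\<in>Z. Im \<mu> > 0}" and "L = {\<mu>\<in>Z. Im \<mu> < 0}"
    and "H = {\<mu>\<in>Z. \<mu> \<in> \<real> \<and> Re \<mu> > 1}" and "I = {\<mu>\<in>Z. \<mu> \<in> \<real> \<and> Re \<mu> \<le> 1}"
  have fin: "finite Z" unfolding Z_def using p0 by (rule poly_roots_finite)
  then have fins: "finite U" "finite L" "finite H" "finite I" 
    by (simp_all add: U_def L_def H_def I_def)
  have order_pos: "\<mu> \<in> Z \<longleftrightarrow> Polynomial.order \<mu> p \<noteq> 0" for \<mu> using p0 by (simp add: Z_def order_root)
  have Z: "Z = (U \<union> L) \<union> (H \<union> I)"
    by (auto simp: U_def L_def H_def I_def complex_is_Real_iff)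
  have "poly p 1 = poly (\<Prod>\<mu>\<in>Z. [:-\<mu>, 1:] ^ Polynomial.order \<mu> p) 1"
    using complex_poly_decompose[of p] p(1) by (simp add: Z_def)
  also have "\<dots> = prod g Z" by (simp add: poly_prod g_def)
  also have "\<dots> = prod g U * prod g L * (prod g H * prod g I)"
    unfolding Z using fins
    by (subst prod.union_disjoint; (subst prod.union_disjoint)?; (subst prod.union_disjoint)?)
       (auto simp: U_def L_def H_def I_def complex_is_Real_iff)
  \<comment> \<open>Roots come in conjugate pairs of equal order, so the factors from U and L multiply to a
    positive number; only the real roots beyond 1 contribute a sign.\<close>
  finally have eq: "poly p 1 = prod g U * prod g L * (prod g H * prod g I)" .
  have "prod g L = prod g (cnj ` U)"
  proof -
    have "L = cnj ` U"
    proof (intro subset_antisym subsetI)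
      fix z assume "z \<in> L"
      then have "cnj z \<in> U" by (auto simp: L_def U_def order_pos order_cnj[OF p(2)])
      then show "z \<in> cnj ` U" by (metis complex_cnj_cnj image_eqI)
    qed (auto simp: L_def U_def order_pos order_cnj[OF p(2)])
    then show ?thesis by simp
  qed
  also have "\<dots> = (\<Prod>\<mu>\<in>U. g (cnj \<mu>))"
    by (subst prod.reindex) (auto intro: inj_onI)
  also have "\<dots> = cnj (prod g U)"
    by (simp add: g_def order_cnj[OF p(2)])
  finally have UL: "prod g U * prod g L = complex_of_real ((cmod (prod g U))\<^sup>2)"
    using complex_norm_square[of "prod g U"] by simp
  have H: "prod g H = (-1) ^ (\<Sum>\<mu>\<in>H. Polynomial.order \<mu> p) * complex_of_real (\<Prod>\<mu>\<in>H. (Re \<mu> - 1) ^ Polynomial.order \<mu> p)"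
  proof -
    have "g \<mu> = (-1) ^ Polynomial.order \<mu> p * complex_of_real ((Re \<mu> - 1) ^ Polynomial.order \<mu> p)" if "\<mu> \<in> H" for \<mu>
    proof -
      have "1 - \<mu> = (-1) * complex_of_real (Re \<mu> - 1)"
        using that by (simp add: H_def complex_eq_iff complex_is_Real_iff)
      then show ?thesis unfolding g_def by (simp only: power_mult_distrib of_real_power)
    qed
    then show ?thesis by (simp add: prod.distrib power_sum)
  qed
  have I: "prod g I = complex_of_real (\<Prod>\<mu>\<in>I. (1 - Re \<mu>) ^ Polynomial.order \<mu> p)"
  proof -
    have "g \<mu> = complex_of_real ((1 - Re \<mu>) ^ Polynomial.order \<mu> p)" if "\<mu> \<in> I" for \<mu>
    proof -
      have "1 - \<mu> = complex_of_real (1 - Re \<mu>)"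
        using that by (simp add: I_def complex_eq_iff complex_is_Real_iff)
      then show ?thesis by (simp add: g_def del: of_real_diff)
    qed
    then show ?thesis by simp
  qed
  let ?t = "(cmod (prod g U))\<^sup>2 * ((\<Prod>\<mu>\<in>H. (Re \<mu> - 1) ^ Polynomial.order \<mu> p) * (\<Prod>\<mu>\<in>I. (1 - Re \<mu>) ^ Polynomial.order \<mu> p))"
  have "poly p 1 = (-1) ^ (\<Sum>\<mu>\<in>H. Polynomial.order \<mu> p) * complex_of_real ?t"
    unfolding eq UL H I by (simp add: mult_ac)
  moreover have "?t > 0"
  proof (intro mult_pos_pos prod_pos ballI)
    have "prod g U \<noteq> 0" using eq nz by auto
    then show "(cmod (prod g U))\<^sup>2 > 0" by simp
    \<comment> \<open>A real root with real part 1 would be the number 1, which \<open>nz\<close>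
      excludes; so these factors are strictly positive.\<close>
    fix \<mu> assume "\<mu> \<in> I"
    then have "Re \<mu> \<noteq> 1" using nz
      by (auto simp: I_def Z_def complex_is_Real_iff complex_eq_iff[of \<mu> 1])
         (metis complex_eq_iff one_complex.simps)
    then show "0 < (1 - Re \<mu>) ^ Polynomial.order \<mu> p" using \<open>\<mu> \<in> I\<close> by (simp add: I_def)
  qed (simp add: H_def)
  moreover have "H = {\<mu>. poly p \<mu> = 0 \<and> \<mu> \<in> \<real> \<and> Re \<mu> > 1}" by (auto simp: H_def Z_def)
  ultimately show ?thesis by blast
qed

text \<open>The determinant is the characteristic polynomial at 1, so its sign is given by the
  number \<open>e\<close> of real eigenvalues above 1. Those with modulus above 1 lie above 1 or
  below -1, whence r = e + p, and r + p has the parity of \<open>e\<close>.\<close>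

lemma abs_det_one_minus_eq_sign:
  fixes A :: "int mat"
  assumes A: "A \<in> carrier_mat n n" and det: "det (1\<^sub>m n - A) \<noteq> 0"
  defines "M \<equiv> map_mat complex_of_int A"
  defines "p \<equiv> eig_count M (\<lambda>\<mu>. \<mu> \<in> \<real> \<and> Re \<mu> < -1)"
    and "r \<equiv> eig_count M (\<lambda>\<mu>. \<mu> \<in> \<real> \<and> cmod \<mu> > 1)"
  shows "\<bar>det (1\<^sub>m n - A)\<bar> = (-1) ^ (r + p) * det (1\<^sub>m n - A)"
proof -
  let ?q = "char_poly M"
  define e where "e = eig_count M (\<lambda>\<mu>. \<mu> \<in> \<real> \<and> Re \<mu> > 1)"
  have M: "M \<in> carrier_mat n n" using A by (simp add: M_def)
  have monic: "lead_coeff ?q = 1" using degree_monic_char_poly[OF M] by simp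
  then have q0: "?q \<noteq> 0" by auto
  have fin: "finite {\<mu>. poly ?q \<mu> = 0 \<and> P \<mu>}" for P
    using poly_roots_finite[OF q0] by (rule rev_finite_subset) auto
  interpret cnj: comm_ring_hom cnj by unfold_locales auto
  have "map_mat cnj M = M" using A by (intro eq_matI) (auto simp: M_def)
  then have real: "map_poly cnj ?q = ?q" using cnj.char_poly_hom[OF M] by simp
  have "- char_matrix M 1 = map_mat of_int (1\<^sub>m n - A)"
    using A by (intro eq_matI) (auto simp: M_def char_matrix_def)
  then have val: "poly ?q 1 = of_int (det (1\<^sub>m n - A))"
    by (simp add: char_poly_matrix[OF M])
  have nz: "poly ?q 1 \<noteq> 0" using val det by simp
  obtain t where t: "t > 0" "poly ?q 1 = (-1) ^ e * complex_of_real t"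
    using poly_one_sign[OF monic real nz] unfolding e_def eig_count_def by blast
  have "complex_of_real (of_int (det (1\<^sub>m n - A))) = complex_of_real ((-1) ^ e * t)"
    using t(2) val by simp
  then have "real_of_int (det (1\<^sub>m n - A)) = (-1) ^ e * t" by (simp only: of_real_eq_iff)
  then have sgn: "\<bar>det (1\<^sub>m n - A)\<bar> = (-1) ^ e * det (1\<^sub>m n - A)"
    using t(1) by (cases "even e") auto
  have "r = e + p"
  proof -
    have "{\<mu>. poly ?q \<mu> = 0 \<and> (\<mu> \<in> \<real> \<and> cmod \<mu> > 1)} =
        {\<mu>. poly ?q \<mu> = 0 \<and> (\<mu> \<in> \<real> \<and> Re \<mu> > 1)} \<union> {\<mu>. poly ?q \<mu> = 0 \<and> (\<mu> \<in> \<real> \<and> Re \<mu> < -1)}"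
      by (auto elim!: Reals_cases)
    then show ?thesis unfolding r_def p_def e_def eig_count_def
      by (simp only:) (rule sum.union_disjoint[OF fin fin], auto)
  qed
  then have "r + p = e + 2 * p" by simp
  then show ?thesis using sgn by (simp add: power_add)
qed

section \<open>Twisted conjugacy in finite groups\<close>

text \<open>Its orbits are the twisted conjugacy classes. The restricted abstraction makes each map
  extensional, as membership in \<open>Bij\<close> demands.\<close>

definition twisted_action :: "('a, 'b) monoid_scheme \<Rightarrow> ('a \<Rightarrow> 'a) \<Rightarrow> 'a \<Rightarrow> 'a \<Rightarrow> 'a" where
  "twisted_action G \<psi> = (\<lambda>g. \<lambda>x\<in>carrier G. g \<otimes>\<^bsub>G\<^esub> x \<otimes>\<^bsub>G\<^esub> inv\<^bsub>G\<^esub> (\<psi> g))"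

text \<open>The action law follows from the multiplicativity of \<psi>, and the inverse of the map
  for g is the map for the inverse of g.\<close>

lemma (in group) twisted_action:
  assumes \<psi>: "\<psi> \<in> hom G G"
  shows "group_action G (carrier G) (twisted_action G \<psi>)"
proof -
  interpret \<psi>: group_hom G G \<psi> by unfold_locales (rule \<psi>)
  have comp: "twisted_action G \<psi> (g \<otimes> h) x = twisted_action G \<psi> g (twisted_action G \<psi> h x)"
    if "g \<in> carrier G" "h \<in> carrier G" "x \<in> carrier G" for g h x
    using that by (simp add: twisted_action_def inv_mult_group m_assoc)
  have one: "twisted_action G \<psi> \<one> x = x" if "x \<in> carrier G" for x
    using that by (simp add: twisted_action_def)
  have closed: "twisted_action G \<psi> g x \<in> carrier G" if "g \<in> carrier G" "x \<in> carrier G" for g x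
    using that by (simp add: twisted_action_def)
  have "bij_betw (twisted_action G \<psi> g) (carrier G) (carrier G)" if g: "g \<in> carrier G" for g
    by (rule bij_betw_byWitness[where f' = "twisted_action G \<psi> (inv g)"])
       (use g closed in \<open>auto simp: comp[symmetric] one\<close>)
  then have Bij: "twisted_action G \<psi> g \<in> Bij (carrier G)" if "g \<in> carrier G" for g
    using that by (auto simp: Bij_def twisted_action_def)
  have "twisted_action G \<psi> \<in> hom G (BijGroup (carrier G))"
  proof (rule homI)
    fix g h assume gh: "g \<in> carrier G" "h \<in> carrier G"
    have "twisted_action G \<psi> (g \<otimes> h) = compose (carrier G) (twisted_action G \<psi> g) (twisted_action G \<psi> h)"
      using comp[OF gh] by (auto simp: compose_def fun_eq_iff twisted_action_def)
    then show "twisted_action G \<psi> (g \<otimes> h) =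
        twisted_action G \<psi> g \<otimes>\<^bsub>BijGroup (carrier G)\<^esub> twisted_action G \<psi> h"
      using gh Bij by (simp add: BijGroup_def)
  qed (simp add: BijGroup_def Bij)
  then show ?thesis
    unfolding group_action_def group_hom_def
    by (simp add: group_BijGroup group_hom_axioms.intro is_group)
qed

lemma phi_conj_iff_orbit:
  assumes "a \<in> carrier G"
  shows "phi_conj G \<psi> a b \<longleftrightarrow> b \<in> orbit G (twisted_action G \<psi>) a"
  using assms by (auto simp: phi_conj_def orbit_def twisted_action_def)

lemma (in group) equiv_phi_conj:
  assumes \<psi>: "\<psi> \<in> hom G G"
  shows "equiv (carrier G) {(a, b). a \<in> carrier G \<and> b \<in> carrier G \<and> phi_conj G \<psi> a b}"
proof -
  interpret group_action G "carrier G" "twisted_action G \<psi>" by (rule twisted_action[OF \<psi>])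
  show ?thesis
  proof (rule equivI)
    show "refl_on (carrier G) {(a, b). a \<in> carrier G \<and> b \<in> carrier G \<and> phi_conj G \<psi> a b}"
      by (auto simp: refl_on_def phi_conj_iff_orbit orbit_refl)
    show "sym {(a, b). a \<in> carrier G \<and> b \<in> carrier G \<and> phi_conj G \<psi> a b}"
      by (rule symI) (auto simp: phi_conj_iff_orbit dest: orbit_sym[rotated 2])
    show "trans {(a, b). a \<in> carrier G \<and> b \<in> carrier G \<and> phi_conj G \<psi> a b}"
    proof (rule transI)
      fix x y z
      assume "(x, y) \<in> {(a, b). a \<in> carrier G \<and> b \<in> carrier G \<and> phi_conj G \<psi> a b}"
        "(y, z) \<in> {(a, b). a \<in> carrier G \<and> b \<in> carrier G \<and> phi_conj G \<psi> a b}"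
      then show "(x, z) \<in> {(a, b). a \<in> carrier G \<and> b \<in> carrier G \<and> phi_conj G \<psi> a b}"
        using orbit_trans[of x y z] by (auto simp: phi_conj_iff_orbit)
    qed
  qed auto
qed

text \<open>The quotient form is the one needed for \<open>card_quotient_fibration\<close>; the
  orbit form that follows is for Burnside's lemma.\<close>

lemma reidemeister_classes_eq_quotient:
  "reidemeister_classes G \<psi> =
    carrier G // {(a, b). a \<in> carrier G \<and> b \<in> carrier G \<and> phi_conj G \<psi> a b}"
  by (auto simp: reidemeister_classes_def quotient_def)

lemma (in group) reidemeister_classes_eq_orbits:
  assumes \<psi>: "\<psi> \<in> hom G G"
  shows "reidemeister_classes G \<psi> = orbits G (carrier G) (twisted_action G \<psi>)"
proof -
  interpret group_action G "carrier G" "twisted_action G \<psi>" by (rule twisted_action[OF \<psi>])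
  have "{b \<in> carrier G. phi_conj G \<psi> a b} = orbit G (twisted_action G \<psi>) a" if a: "a \<in> carrier G" for a
  proof -
    have "orbit G (twisted_action G \<psi>) a \<subseteq> carrier G"
      using a element_image by (fastforce simp: orbit_def)
    then show ?thesis using a by (auto simp: phi_conj_iff_orbit)
  qed
  then show ?thesis by (auto simp: reidemeister_classes_def orbits_def)
qed

lemma (in group) conj_classes_eq_orbits:
  "conj_classes G = orbits G (carrier G) (\<lambda>g. \<lambda>h\<in>carrier G. g \<otimes> h \<otimes> inv g)"
  by (auto simp: conj_classes_def orbits_def orbit_def image_def)

text \<open>An element x is fixed by g iff g x = x \<psi>(g), that is, iff \<psi>(g) is g conjugated
  by the inverse of x. Such x exist only if \<psi>(g) lies in the class of g, and then they form a
  coset of the centralizer of g.\<close>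

lemma (in group) card_invariants_twisted_action:
  assumes \<psi>: "\<psi> \<in> hom G G" and C: "C \<in> conj_classes G" and g: "g \<in> C"
  shows "card (invariants (carrier G) (twisted_action G \<psi>) g) =
    (if \<psi> g \<in> C then card (stabilizer G (\<lambda>g. \<lambda>h\<in>carrier G. g \<otimes> h \<otimes> inv g) g) else 0)"
proof -
  interpret \<psi>: group_hom G G \<psi> by unfold_locales (rule \<psi>)
  interpret conj: group_action G "carrier G" "\<lambda>g. \<lambda>h\<in>carrier G. g \<otimes> h \<otimes> inv g"
    by (rule action_by_conjugation)
  let ?St = "stabilizer G (\<lambda>g. \<lambda>h\<in>carrier G. g \<otimes> h \<otimes> inv g) g"
  have C_orb: "C \<in> orbits G (carrier G) (\<lambda>g. \<lambda>h\<in>carrier G. g \<otimes> h \<otimes> inv g)"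
    using C by (simp add: conj_classes_eq_orbits)
  then have gG: "g \<in> carrier G" using conj.orbits_coverture g by blast
  have "C = orbit G (\<lambda>g. \<lambda>h\<in>carrier G. g \<otimes> h \<otimes> inv g) g"
    using conj.disjoint_union[OF C_orb, of "orbit G (\<lambda>g. \<lambda>h\<in>carrier G. g \<otimes> h \<otimes> inv g) g"]
      g gG conj.orbit_refl by (auto simp: orbits_def)
  then have C_eq: "C = {y \<otimes> g \<otimes> inv y | y. y \<in> carrier G}" using gG by (simp add: orbit_def)
  have inv_eq: "invariants (carrier G) (twisted_action G \<psi>) g = {x \<in> carrier G. \<psi> g = inv x \<otimes> g \<otimes> x}"
  proof -
    have "g \<otimes> x \<otimes> inv (\<psi> g) = x \<longleftrightarrow> \<psi> g = inv x \<otimes> g \<otimes> x" if x: "x \<in> carrier G" for x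
    proof -
      have "g \<otimes> x \<otimes> inv (\<psi> g) = x \<longleftrightarrow> g \<otimes> x = x \<otimes> \<psi> g"
        using x gG by (metis \<psi>.hom_closed inv_closed m_closed inv_solve_right)
      also have "\<dots> \<longleftrightarrow> \<psi> g = inv x \<otimes> (g \<otimes> x)"
        using x gG by (metis \<psi>.hom_closed m_closed inv_solve_left)
      finally show ?thesis using x gG by (simp add: m_assoc)
    qed
    then show ?thesis by (auto simp: invariants_def twisted_action_def)
  qed
  show ?thesis
  proof (cases "\<psi> g \<in> C")
    case True
    then obtain y where y: "y \<in> carrier G" "\<psi> g = y \<otimes> g \<otimes> inv y" using C_eq by auto
    have iff: "inv x \<otimes> g \<otimes> x = y \<otimes> g \<otimes> inv y \<longleftrightarrow> x \<otimes> y \<otimes> g \<otimes> inv (x \<otimes> y) = g" 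
      if x: "x \<in> carrier G" for x
    proof -
      have "x \<otimes> y \<otimes> g \<otimes> inv (x \<otimes> y) = x \<otimes> (y \<otimes> g \<otimes> inv y) \<otimes> inv x"
        using x y(1) gG by (simp add: inv_mult_group m_assoc)
      moreover have "x \<otimes> (inv x \<otimes> g \<otimes> x) \<otimes> inv x = g"
        using x gG by (rule conjugation_is_surj)
      ultimately show ?thesis
        using x y(1) gG conjugation_is_inj[of x "inv x \<otimes> g \<otimes> x" "y \<otimes> g \<otimes> inv y"] by auto
    qed
    \<comment> \<open>With \<psi>(g) equal to g conjugated by \<open>y\<close>, x is a solution
      exactly when x y centralizes g.\<close>
    have "bij_betw (\<lambda>x. x \<otimes> y) {x \<in> carrier G. \<psi> g = inv x \<otimes> g \<otimes> x} ?St"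
    proof (rule bij_betw_byWitness[where f' = "\<lambda>x. x \<otimes> inv y"])
      show "(\<lambda>x. x \<otimes> y) ` {x \<in> carrier G. \<psi> g = inv x \<otimes> g \<otimes> x} \<subseteq> ?St"
      proof
        fix z assume "z \<in> (\<lambda>x. x \<otimes> y) ` {x \<in> carrier G. \<psi> g = inv x \<otimes> g \<otimes> x}"
        then obtain x where x: "x \<in> carrier G" "\<psi> g = inv x \<otimes> g \<otimes> x" "z = x \<otimes> y" by blast
        then have "z \<otimes> g \<otimes> inv z = g" using iff[OF x(1)] y(2) by simp
        then show "z \<in> ?St" using x y(1) gG by (simp add: stabilizer_def)
      qed
      show "(\<lambda>x. x \<otimes> inv y) ` ?St \<subseteq> {x \<in> carrier G. \<psi> g = inv x \<otimes> g \<otimes> x}"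
      proof
        fix z assume "z \<in> (\<lambda>x. x \<otimes> inv y) ` ?St"
        then obtain x where x: "x \<in> carrier G" "x \<otimes> g \<otimes> inv x = g" "z = x \<otimes> inv y"
          using gG by (auto simp: stabilizer_def)
        have "x \<otimes> inv y \<otimes> y = x" using x(1) y(1) by (simp add: m_assoc)
        then show "z \<in> {x \<in> carrier G. \<psi> g = inv x \<otimes> g \<otimes> x}"
          using iff[of z] x y by auto
      qed
    qed (use y(1) in \<open>auto simp: m_assoc stabilizer_def\<close>)
    then show ?thesis using True by (simp add: inv_eq bij_betw_same_card)
  next
    case False
    have "\<psi> g \<noteq> inv x \<otimes> g \<otimes> x" if "x \<in> carrier G" for x
      using that False C_eq by (auto dest!: spec[of _ "inv x"])
    then have "invariants (carrier G) (twisted_action G \<psi>) g = {}" by (auto simp: inv_eq)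
    then show ?thesis using False by simp
  qed
qed

text \<open>A homomorphism sends conjugate elements to conjugate elements, so one element decides
  whether a class is mapped into itself. This justifies testing on the representative chosen by
  \<open>SOME\<close>.\<close>

lemma (in group) conj_class_stable:
  assumes \<psi>: "\<psi> \<in> hom G G" and C: "C \<in> conj_classes G" and gh: "g \<in> C" "h \<in> C" and g: "\<psi> g \<in> C"
  shows "\<psi> h \<in> C"
proof -
  interpret \<psi>: group_hom G G \<psi> by unfold_locales (rule \<psi>)
  obtain x where x: "x \<in> carrier G" "C = {y \<otimes> x \<otimes> inv y | y. y \<in> carrier G}"
    using C by (auto simp: conj_classes_def)
  obtain a b c where a: "a \<in> carrier G" "g = a \<otimes> x \<otimes> inv a"
    and b: "b \<in> carrier G" "h = b \<otimes> x \<otimes> inv b" and c: "c \<in> carrier G" "\<psi> g = c \<otimes> x \<otimes> inv c"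
    using gh g x(2) by blast
  \<comment> \<open>Since b times the inverse of a conjugates \<open>g\<close> to \<open>h\<close>,
    its image under \<psi> conjugates the images.\<close>
  define d where "d = \<psi> (b \<otimes> inv a)"
  have d: "d \<in> carrier G" using a b by (simp add: d_def)
  have cancel: "inv a \<otimes> (a \<otimes> z) = z" if "z \<in> carrier G" for z
    using that a(1) m_assoc[of "inv a" a z] by simp
  have "h = (b \<otimes> inv a) \<otimes> g \<otimes> inv (b \<otimes> inv a)"
    using a b x(1) by (simp add: inv_mult_group m_assoc cancel)
  then have "\<psi> h = \<psi> ((b \<otimes> inv a) \<otimes> g \<otimes> inv (b \<otimes> inv a))" by simp
  also have "\<dots> = d \<otimes> \<psi> g \<otimes> inv d"
    unfolding d_def using a b x(1) by (simp only: \<psi>.hom_inv \<psi>.hom_mult inv_closed m_closed)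
  also have "\<dots> = (d \<otimes> c) \<otimes> x \<otimes> inv (d \<otimes> c)"
    using c d x(1) by (simp add: inv_mult_group m_assoc)
  finally show ?thesis using c(1) d x(2) by auto
qed

text \<open>Burnside's lemma gives the number of twisted classes times the group order as a sum of
  fixed-point counts. Grouped by ordinary classes, each \<psi>-invariant class contributes the
  orders of the centralizers of its elements, in total the group order, and every other class
  contributes 0.\<close>

lemma (in group) card_reidemeister_classes_finite:
  assumes fin: "finite (carrier G)" and \<psi>: "\<psi> \<in> hom G G"
  shows "complex_of_nat (card (reidemeister_classes G \<psi>)) =
    (\<Sum>C\<in>conj_classes G. class_coord C (B_op G \<psi> (class_indicator C)))"
proof -
  interpret conj: group_action G "carrier G" "\<lambda>g. \<lambda>h\<in>carrier G. g \<otimes> h \<otimes> inv g"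
    by (rule action_by_conjugation)
  interpret twisted: group_action G "carrier G" "twisted_action G \<psi>" by (rule twisted_action[OF \<psi>])
  let ?st = "\<lambda>g. card (stabilizer G (\<lambda>g. \<lambda>h\<in>carrier G. g \<otimes> h \<otimes> inv g) g)"
  let ?fix = "\<lambda>g. card (invariants (carrier G) (twisted_action G \<psi>) g)"
  let ?P = "\<lambda>C. \<psi> (SOME x. x \<in> C) \<in> C"
  have some: "(SOME x. x \<in> C) \<in> C" "C \<subseteq> carrier G" if "C \<in> conj_classes G" for C
  proof -
    from that obtain x where x: "x \<in> carrier G" "C = {y \<otimes> x \<otimes> inv y | y. y \<in> carrier G}"
      by (auto simp: conj_classes_def)
    then have "x \<in> C" by (auto intro: exI[of _ \<one>])
    then show "(SOME x. x \<in> C) \<in> C" by (rule someI)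
    show "C \<subseteq> carrier G" using x by auto
  qed
  have class_sum: "(\<Sum>g\<in>C. ?fix g) = (if ?P C then order G else 0)" if C: "C \<in> conj_classes G" for C
  proof -
    have "(\<Sum>g\<in>C. ?fix g) = (\<Sum>g\<in>C. if ?P C then ?st g else 0)"
    proof (rule sum.cong[OF refl])
      fix g assume g: "g \<in> C"
      then have "\<psi> g \<in> C \<longleftrightarrow> ?P C" using conj_class_stable[OF \<psi> C] some[OF C] by blast
      then show "?fix g = (if ?P C then ?st g else 0)"
        by (simp add: card_invariants_twisted_action[OF \<psi> C g])
    qed
    then show ?thesis
      using conj.card_stablizer_sum[OF fin] C by (simp add: conj_classes_eq_orbits)
  qed
  have "card (reidemeister_classes G \<psi>) * order G = (\<Sum>g\<in>carrier G. ?fix g)"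
    by (simp add: reidemeister_classes_eq_orbits[OF \<psi>] twisted.burnside[OF fin fin])
  also have "\<dots> = (\<Sum>C\<in>conj_classes G. \<Sum>g\<in>C. ?fix g)"
    unfolding conj_classes_eq_orbits by (rule conj.disjoint_sum[OF fin, symmetric])
  also have "\<dots> = (\<Sum>C\<in>conj_classes G. if ?P C then 1 else 0) * order G"
    unfolding sum_distrib_right by (rule sum.cong) (auto simp: class_sum)
  finally have "card (reidemeister_classes G \<psi>) = (\<Sum>C\<in>conj_classes G. if ?P C then 1 else 0)"
    using fin order_gt_0_iff_finite by simp
  then have "complex_of_nat (card (reidemeister_classes G \<psi>)) = (\<Sum>C\<in>conj_classes G. if ?P C then 1 else 0)"
    by (simp add: if_distrib cong: if_cong)
  \<comment> \<open>The diagonal entry of \<open>B\<close> at the indicator of C is that indicator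
    evaluated at \<psi> of the representative.\<close>
  also have "\<dots> = (\<Sum>C\<in>conj_classes G. class_coord C (B_op G \<psi> (class_indicator C)))"
    using some by (intro sum.cong refl) (auto simp: class_coord_def B_op_def class_indicator_def)
  finally show ?thesis .
qed

section \<open>Endomorphisms of the product group\<close>

lemma Zk_simps [simp]:
  "(\<lambda>_. 0) \<in> Zk k" "v \<in> Zk k \<Longrightarrow> w \<in> Zk k \<Longrightarrow> (\<lambda>i. v i + w i) \<in> Zk k"
  "v \<in> Zk k \<Longrightarrow> (\<lambda>i. - v i) \<in> Zk k" "v \<in> Zk k \<Longrightarrow> (\<lambda>i. c * v i) \<in> Zk k"
  by (auto simp: Zk_def)

lemma carrier_ZkF: "(v, x) \<in> carrier (ZkF k F) \<longleftrightarrow> v \<in> Zk k \<and> x \<in> carrier F"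
  by (simp add: ZkF_def)

lemma carrier_ZkF_eq: "carrier (ZkF k F) = Zk k \<times> carrier F"
  by (auto simp: ZkF_def)

lemma mult_ZkF [simp]: "(v, x) \<otimes>\<^bsub>ZkF k F\<^esub> (w, y) = (\<lambda>i. v i + w i, x \<otimes>\<^bsub>F\<^esub> y)"
  by (simp add: ZkF_def)

lemma one_ZkF [simp]: "\<one>\<^bsub>ZkF k F\<^esub> = (\<lambda>_. 0, \<one>\<^bsub>F\<^esub>)"
  by (simp add: ZkF_def)

lemma (in group) group_ZkF: "group (ZkF k G)"
proof (rule groupI)
  fix p assume "p \<in> carrier (ZkF k G)"
  then obtain v x where "p = (v, x)" "v \<in> Zk k" "x \<in> carrier G" by (cases p) (auto simp: carrier_ZkF)
  then show "\<exists>q\<in>carrier (ZkF k G). q \<otimes>\<^bsub>ZkF k G\<^esub> p = \<one>\<^bsub>ZkF k G\<^esub>"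
    by (intro bexI[of _ "(\<lambda>i. - v i, inv x)"]) (auto simp: carrier_ZkF)
qed (auto simp: carrier_ZkF m_assoc add.assoc)

lemma (in group) inv_ZkF:
  assumes "v \<in> Zk k" "x \<in> carrier G"
  shows "inv\<^bsub>ZkF k G\<^esub> (v, x) = (\<lambda>i. - v i, inv x)"
  by (rule group.inv_equality[OF group_ZkF]) (use assms in \<open>auto simp: carrier_ZkF\<close>)

lemma (in group) pow_ZkF: "(v, x) [^]\<^bsub>ZkF k G\<^esub> (n::nat) = (\<lambda>i. int n * v i, x [^] n)"
proof (induction n)
  case (Suc n)
  then show ?case by (simp add: algebra_simps)
qed simp

text \<open>A positive multiple of an integer vector vanishes only if the vector does; conversely
  the order of the finite group annihilates its elements.\<close>

lemma (in group) torsion_elems_ZkF: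
  assumes "finite (carrier G)"
  shows "torsion_elems (ZkF k G) = {(\<lambda>_. 0, x) | x. x \<in> carrier G}"
proof (intro subset_antisym subsetI)
  fix p assume "p \<in> torsion_elems (ZkF k G)"
  then obtain v x and n :: nat where "p = (v, x)" "x \<in> carrier G" "n > 0" "(\<lambda>i. int n * v i) = (\<lambda>_. 0)"
    by (cases p) (auto simp: torsion_elems_def carrier_ZkF pow_ZkF)
  then show "p \<in> {(\<lambda>_. 0, x) | x. x \<in> carrier G}" by (auto simp: fun_eq_iff)
next
  fix p :: "(nat \<Rightarrow> int) \<times> 'a" assume "p \<in> {(\<lambda>_. 0, x) | x. x \<in> carrier G}"
  then obtain x where x: "p = (\<lambda>_. 0, x)" "x \<in> carrier G" by blast
  have "order G > 0" using assms by (simp add: order_gt_0_iff_finite)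
  moreover have "p [^]\<^bsub>ZkF k G\<^esub> order G = \<one>\<^bsub>ZkF k G\<^esub>"
    using x pow_order_eq_1 by (simp add: pow_ZkF)
  ultimately show "p \<in> torsion_elems (ZkF k G)"
    using x by (auto simp: torsion_elems_def carrier_ZkF)
qed

lemma (in group_hom) hom_torsion_elems: "h ` torsion_elems G \<subseteq> torsion_elems H"
proof (rule image_subsetI)
  fix x assume "x \<in> torsion_elems G"
  then obtain n :: nat where "x \<in> carrier G" "n > 0" "x [^] n = \<one>" by (auto simp: torsion_elems_def)
  then show "h x \<in> torsion_elems H"
    using hom_nat_pow[of x n] by (auto simp: torsion_elems_def intro!: exI[of _ n])
qed

text \<open>Additivity gives compatibility with natural, then integer multiples; afterwards the top
  coordinate is split off one at a time.\<close>

lemma additive_on_Zk: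
  fixes H :: "(nat \<Rightarrow> int) \<Rightarrow> int"
  assumes add: "\<And>v w. v \<in> Zk k \<Longrightarrow> w \<in> Zk k \<Longrightarrow> H (\<lambda>i. v i + w i) = H v + H w"
    and v: "v \<in> Zk k"
  shows "H v = (\<Sum>j<k. v j * H (unit_vec_Z j))"
proof -
  have zero: "H (\<lambda>_. 0) = 0" using add[of "\<lambda>_. 0" "\<lambda>_. 0"] by simp
  have nat_mult: "H (\<lambda>i. int n * w i) = int n * H w" if w: "w \<in> Zk k" for n w
  proof (induction n)
    case (Suc n)
    have "(\<lambda>i. int (Suc n) * w i) = (\<lambda>i. int n * w i + w i)" by (simp add: algebra_simps)
    then show ?case using Suc add[of "\<lambda>i. int n * w i" w] w by (simp add: algebra_simps)
  qed (simp add: zero)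
  have minus: "H (\<lambda>i. - w i) = - H w" if "w \<in> Zk k" for w
    using add[of w "\<lambda>i. - w i"] that by (simp add: zero)
  have mult: "H (\<lambda>i. c * w i) = c * H w" if w: "w \<in> Zk k" for c w
  proof (cases c)
    case (nonneg n)
    then show ?thesis using nat_mult[OF w] by simp
  next
    case (neg n)
    have "(\<lambda>i. c * w i) = (\<lambda>i. - (int (Suc n) * w i))" by (simp only: neg mult_minus_left)
    then have "H (\<lambda>i. c * w i) = - H (\<lambda>i. int (Suc n) * w i)"
      using minus[of "\<lambda>i. int (Suc n) * w i"] w by simp
    then show ?thesis by (simp only: nat_mult[OF w] neg mult_minus_left)
  qed
  \<comment> \<open>The induction runs over \<open>m\<close> with \<open>k\<close> fixed, because
    additivity is available on \<open>Zk k\<close>.\<close>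
  have "m \<le> k \<Longrightarrow> w \<in> Zk m \<Longrightarrow> H w = (\<Sum>j<m. w j * H (unit_vec_Z j))" for m w
  proof (induction m arbitrary: w)
    case 0
    then have "w = (\<lambda>_. 0)" by (auto simp: Zk_def)
    then show ?case by (simp add: zero)
  next
    case (Suc m)
    let ?w = "w(m := 0)" and ?e = "unit_vec_Z m"
    have w: "?w \<in> Zk m" "?w \<in> Zk k" "?e \<in> Zk k"
      using Suc.prems by (auto simp: Zk_def unit_vec_Z_def)
    have "w = (\<lambda>i. ?w i + w m * ?e i)" by (auto simp: unit_vec_Z_def)
    then have "H w = H ?w + w m * H ?e"
      using add[OF w(2), of "\<lambda>i. w m * ?e i"] mult[OF w(3)] w(3) by simp
    also have "H ?w = (\<Sum>j<m. ?w j * H (unit_vec_Z j))" using Suc w(1) by simp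
    also have "\<dots> = (\<Sum>j<m. w j * H (unit_vec_Z j))" by (intro sum.cong) auto
    finally show ?case by simp
  qed
  from this[OF order.refl v] show ?thesis .
qed

section \<open>The maps induced on \<int>^k and on F, and the product formula\<close>

locale ZkF_endomorphism = group F for F :: "('a, 'b) monoid_scheme" (structure) +
  fixes k :: nat and \<phi> :: "(nat \<Rightarrow> int) \<times> 'a \<Rightarrow> (nat \<Rightarrow> int) \<times> 'a"
  assumes finite_carrier: "finite (carrier F)"
    and hom: "\<phi> \<in> hom (ZkF k F) (ZkF k F)"
begin

sublocale G: group "ZkF k F" by (rule group_ZkF)
sublocale \<phi>: group_hom "ZkF k F" "ZkF k F" \<phi> by unfold_locales (rule hom)

abbreviation "\<psi> \<equiv> phi_tors F \<phi>"

text \<open>The matrix is kept over the integers so that the lattice index applies;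
  \<open>phi_inf_mat\<close> is its complex image.\<close>

definition A :: "int mat" where
  "A = mat k k (\<lambda>(i, j). fst (\<phi> (unit_vec_Z j, \<one>)) i)"

lemma A_carrier: "A \<in> carrier_mat k k"
  by (simp add: A_def)

lemma phi_inf_mat_eq: "phi_inf_mat k F \<phi> = map_mat complex_of_int A"
  by (auto simp: phi_inf_mat_def A_def)

lemma \<phi>_closed: "v \<in> Zk k \<Longrightarrow> x \<in> carrier F \<Longrightarrow> fst (\<phi> (v, x)) \<in> Zk k \<and> snd (\<phi> (v, x)) \<in> carrier F"
  using \<phi>.hom_closed[of "(v, x)"] by (cases "\<phi> (v, x)") (simp add: carrier_ZkF)

text \<open>The copy of F in the product is the set of torsion elements, which every endomorphism
  preserves.\<close>

lemma \<phi>_torsion: "\<phi> ` {(\<lambda>_. 0, x) | x. x \<in> carrier F} \<subseteq> {(\<lambda>_. 0, x) | x. x \<in> carrier F}"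
  using \<phi>.hom_torsion_elems by (simp add: torsion_elems_ZkF[OF finite_carrier])

lemma \<phi>_zero: "x \<in> carrier F \<Longrightarrow> \<phi> (\<lambda>_. 0, x) = (\<lambda>_. 0, \<psi> x)"
  using \<phi>_torsion by (fastforce simp: phi_tors_def)

lemma \<psi>_hom: "\<psi> \<in> hom F F"
proof (rule homI)
  fix x y assume x: "x \<in> carrier F" and y: "y \<in> carrier F"
  show "\<psi> x \<in> carrier F" using \<phi>_closed[OF Zk_simps(1) x] by (simp add: phi_tors_def)
  have "\<phi> (\<lambda>_. 0, x \<otimes> y) = \<phi> (\<lambda>_. 0, x) \<otimes>\<^bsub>ZkF k F\<^esub> \<phi> (\<lambda>_. 0, y)"
    using \<phi>.hom_mult[of "(\<lambda>_. 0, x)" "(\<lambda>_. 0, y)"] x y by (simp add: carrier_ZkF)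
  then show "\<psi> (x \<otimes> y) = \<psi> x \<otimes> \<psi> y" using x y by (simp add: \<phi>_zero)
qed

text \<open>Write (v, x) as the product of (v, 1) and (0, x). The second factor has torsion image
  and adds nothing to the \<int>^k-component; the first is additive in v.\<close>

lemma fst_\<phi>:
  assumes v: "v \<in> Zk k" and x: "x \<in> carrier F" and i: "i < k"
  shows "fst (\<phi> (v, x)) i = (A *\<^sub>v vec k v) $ i"
proof -
  have mult: "fst (\<phi> (\<lambda>i. v i + w i, y \<otimes> z)) i = fst (\<phi> (v, y)) i + fst (\<phi> (w, z)) i"
    if "v \<in> Zk k" "w \<in> Zk k" "y \<in> carrier F" "z \<in> carrier F" for v w y z
    using \<phi>.hom_mult[of "(v, y)" "(w, z)"] that
    by (cases "\<phi> (v, y)"; cases "\<phi> (w, z)") (simp add: carrier_ZkF)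
  have "fst (\<phi> (v, x)) i = fst (\<phi> (v, \<one>)) i"
    using mult[OF v Zk_simps(1) one_closed x] x by (simp add: \<phi>_zero)
  also have "\<dots> = (\<Sum>j<k. v j * fst (\<phi> (unit_vec_Z j, \<one>)) i)"
    by (rule additive_on_Zk[OF _ v, where H = "\<lambda>v. fst (\<phi> (v, \<one>)) i"])
       (use mult[OF _ _ one_closed one_closed] in simp)
  also have "\<dots> = (A *\<^sub>v vec k v) $ i"
    using i by (simp add: A_def scalar_prod_def atLeast0LessThan mult.commute)
  finally show ?thesis .
qed

text \<open>The F-component of \<phi> (w, g) may depend on w as well as on g, so it cannot be
  replaced by \<psi> g here.\<close>

lemma phi_conj_iff:
  assumes "v \<in> Zk k" "x \<in> carrier F"
  shows "phi_conj (ZkF k F) \<phi> (v, x) (v', x') \<longleftrightarrow>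
    (\<exists>w\<in>Zk k. \<exists>g\<in>carrier F. v' = (\<lambda>i. w i + v i - fst (\<phi> (w, g)) i) \<and>
      x' = g \<otimes> x \<otimes> inv (snd (\<phi> (w, g))))"
proof -
  have *: "(w, g) \<otimes>\<^bsub>ZkF k F\<^esub> (v, x) \<otimes>\<^bsub>ZkF k F\<^esub> inv\<^bsub>ZkF k F\<^esub> \<phi> (w, g) =
      (\<lambda>i. w i + v i - fst (\<phi> (w, g)) i, g \<otimes> x \<otimes> inv (snd (\<phi> (w, g))))"
    if "w \<in> Zk k" "g \<in> carrier F" for w g
    using \<phi>_closed[OF that] by (cases "\<phi> (w, g)") (simp add: inv_ZkF)
  have "phi_conj (ZkF k F) \<phi> (v, x) (v', x') \<longleftrightarrow> (\<exists>w\<in>Zk k. \<exists>g\<in>carrier F.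
      (v', x') = (w, g) \<otimes>\<^bsub>ZkF k F\<^esub> (v, x) \<otimes>\<^bsub>ZkF k F\<^esub> inv\<^bsub>ZkF k F\<^esub> \<phi> (w, g))"
    unfolding phi_conj_def carrier_ZkF_eq by blast
  then show ?thesis by (simp add: * del: mult_ZkF)
qed

abbreviation "R \<equiv> {(a, b). a \<in> carrier (ZkF k F) \<and> b \<in> carrier (ZkF k F) \<and> phi_conj (ZkF k F) \<phi> a b}"

lemma IA_carrier: "1\<^sub>m k - A \<in> carrier_mat k k"
  by (rule minus_carrier_mat[OF A_carrier])

text \<open>By \<open>fst_\<phi>\<close> the element g drops out, so twisted conjugation translates
  the \<int>^k-component by a lattice vector.\<close>

lemma vec_conj_fst:
  assumes "v \<in> Zk k" "w \<in> Zk k" "g \<in> carrier F"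
  shows "vec k (\<lambda>i. w i + v i - fst (\<phi> (w, g)) i) = vec k v + (1\<^sub>m k - A) *\<^sub>v vec k w"
proof -
  have "(1\<^sub>m k - A) *\<^sub>v vec k w = vec k w - A *\<^sub>v vec k w"
    using A_carrier by (subst minus_mult_distrib_mat_vec[of _ k k]) auto
  then show ?thesis
    using A_carrier by (intro eq_vecI) (auto simp: fst_\<phi>[OF assms(2,3)] simp del: index_mult_mat_vec)
qed

lemma R_lattice_rel:
  assumes "(a, b) \<in> R"
  shows "(vec k (fst a), vec k (fst b)) \<in> lattice_rel k (1\<^sub>m k - A)"
proof -
  obtain v x v' x' where ab: "a = (v, x)" "b = (v', x')" by (cases a, cases b)
  then have vx: "v \<in> Zk k" "x \<in> carrier F" using assms by (auto simp: carrier_ZkF)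
  then obtain w g where "w \<in> Zk k" "g \<in> carrier F" "v' = (\<lambda>i. w i + v i - fst (\<phi> (w, g)) i)"
    using assms ab phi_conj_iff[OF vx] by auto
  then have "vec k (fst b) = vec k (fst a) + (1\<^sub>m k - A) *\<^sub>v vec k w"
    using vec_conj_fst[OF vx(1)] ab by simp
  then show ?thesis unfolding lattice_rel_def using vec_carrier by blast
qed

text \<open>Identifies the two encodings of \<int>^k: sequences vanishing from index k on, and
  vectors of dimension k.\<close>

lemma vec_Zk: "vec k ` Zk k = carrier_vec k" "inj_on (vec k) (Zk k)"
proof -
  have "v \<in> vec k ` Zk k" if "v \<in> carrier_vec k" for v :: "int vec"
    using that by (intro image_eqI[of _ _ "\<lambda>i. if i < k then v $ i else 0"]) (auto simp: Zk_def)
  then show "vec k ` Zk k = (carrier_vec k :: int vec set)" by auto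
  show "inj_on (vec k :: _ \<Rightarrow> int vec) (Zk k)"
  proof (rule inj_onI)
    fix v w :: "nat \<Rightarrow> int" assume vw: "v \<in> Zk k" "w \<in> Zk k" "vec k v = vec k w"
    have "v i = w i" for i
    proof (cases "i < k")
      case True
      then show ?thesis using arg_cong[OF vw(3), of "\<lambda>u. u $ i"] by simp
    qed (use vw in \<open>auto simp: Zk_def\<close>)
    then show "v = w" by blast
  qed
qed

lemma lift_lattice_rel:
  assumes a: "a \<in> carrier (ZkF k F)" and y: "(vec k (fst a), y) \<in> lattice_rel k (1\<^sub>m k - A)"
  shows "\<exists>b. (a, b) \<in> R \<and> vec k (fst b) = y"
proof -
  obtain v x where vx: "a = (v, x)" "v \<in> Zk k" "x \<in> carrier F" using a by (cases a) (auto simp: carrier_ZkF)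
  obtain u where u: "u \<in> carrier_vec k" "y = vec k v + (1\<^sub>m k - A) *\<^sub>v u"
    using y vx by (auto simp: lattice_rel_def)
  obtain w where w: "w \<in> Zk k" "u = vec k w" using u(1) vec_Zk(1) by blast
  \<comment> \<open>Conjugation by (w, 1) realises the prescribed translation; the F-component may
    land anywhere.\<close>
  let ?b = "(\<lambda>i. w i + v i - fst (\<phi> (w, \<one>)) i, \<one> \<otimes> x \<otimes> inv (snd (\<phi> (w, \<one>))))"
  have "phi_conj (ZkF k F) \<phi> a ?b"
    unfolding vx(1) phi_conj_iff[OF vx(2,3)] using w(1) one_closed by blast
  moreover have "?b \<in> carrier (ZkF k F)"
    using \<phi>_closed[OF w(1) one_closed] w vx by (auto simp: carrier_ZkF Zk_def)
  ultimately have "(a, ?b) \<in> R" using a by blast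
  moreover have "vec k (fst ?b) = y" using vec_conj_fst[OF vx(2) w(1) one_closed] u w by simp
  ultimately show ?thesis by blast
qed

text \<open>Finitely many twisted classes leave finitely many lattice cosets. The index is then
  positive, so the determinant is nonzero and 1 - A is injective. Over one point of \<int>^k only
  conjugation by F is left, and \<open>card_quotient_fibration\<close> yields the product.\<close>

lemma card_reidemeister_classes:
  assumes fin: "finite (reidemeister_classes (ZkF k F) \<phi>)"
  shows "det (1\<^sub>m k - A) \<noteq> 0"
    and "card (reidemeister_classes (ZkF k F) \<phi>) = nat \<bar>det (1\<^sub>m k - A)\<bar> * card (reidemeister_classes F \<psi>)"
proof -
  let ?L = "lattice_rel k (1\<^sub>m k - A)"
  note L = equiv_lattice_rel[OF IA_carrier]
  have R: "equiv (carrier (ZkF k F)) R" by (rule G.equiv_phi_conj[OF hom])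
  \<comment> \<open>The coset of v comes from the class of (v, 1): any representative of that class
    has its \<int>^k-component in the same coset.\<close>
  have "carrier_vec k // ?L \<subseteq> (\<lambda>E. ?L `` {vec k (fst (SOME a. a \<in> E))}) ` (carrier (ZkF k F) // R)"
  proof
    fix D assume "D \<in> carrier_vec k // ?L"
    then obtain y where "y \<in> carrier_vec k" "D = ?L `` {y}" by (rule quotientE)
    then obtain v where v: "v \<in> Zk k" "D = ?L `` {vec k v}" by (metis vec_Zk(1) imageE)
    let ?a = "(v, \<one>)"
    have a: "?a \<in> carrier (ZkF k F)" using v by (simp add: carrier_ZkF)
    let ?b = "SOME a. a \<in> R `` {?a}"
    have "?b \<in> R `` {?a}" by (rule someI, rule equiv_class_self[OF R a])
    then have "(vec k (fst ?a), vec k (fst ?b)) \<in> ?L" by (intro R_lattice_rel) blast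
    then have "?L `` {vec k (fst ?a)} = ?L `` {vec k (fst ?b)}" by (rule equiv_class_eq[OF L])
    then have "D = ?L `` {vec k (fst ?b)}" using v by simp
    then show "D \<in> (\<lambda>E. ?L `` {vec k (fst (SOME a. a \<in> E))}) ` (carrier (ZkF k F) // R)"
      using quotientI[OF a, of R] by (rule image_eqI)
  qed
  then have "finite (carrier_vec k // ?L)"
    by (rule finite_subset) (use fin in \<open>simp add: reidemeister_classes_eq_quotient\<close>)
  moreover have "carrier_vec k // ?L \<noteq> {}"
    unfolding quotient_is_empty using zero_carrier_vec by blast
  ultimately have "card (carrier_vec k // ?L) \<noteq> 0" by simp
  then show det: "det (1\<^sub>m k - A) \<noteq> 0" by (simp add: lattice_index_eq_abs_det[OF IA_carrier])
  have inj: "w = (\<lambda>_. 0)" if w: "w \<in> Zk k" and eq: "(1\<^sub>m k - A) *\<^sub>v vec k w = 0\<^sub>v k" for w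
  proof -
    have "vec k w = 0\<^sub>v k"
      using det_0_iff_vec_prod_zero[OF IA_carrier] det eq by (meson vec_carrier)
    then show ?thesis using inj_onD[OF vec_Zk(2), of w "\<lambda>_. 0"] w by (auto simp: zero_vec_def)
  qed
  have "card (carrier (ZkF k F) // R) = card (carrier_vec k // ?L) *
      card (carrier F // {(a, b). a \<in> carrier F \<and> b \<in> carrier F \<and> phi_conj F \<psi> a b})"
  proof (rule card_quotient_fibration[OF R L equiv_phi_conj[OF \<psi>_hom], where f = "\<lambda>p. (vec k (fst p), snd p)"])
    show "bij_betw (\<lambda>p. (vec k (fst p), snd p)) (carrier (ZkF k F)) (carrier_vec k \<times> carrier F)"
      unfolding bij_betw_def
    proof
      show "inj_on (\<lambda>p. (vec k (fst p), snd p :: 'a)) (carrier (ZkF k F))"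
        using inj_onD[OF vec_Zk(2)] by (intro inj_onI) (auto simp: carrier_ZkF)
      show "(\<lambda>p. (vec k (fst p), snd p)) ` carrier (ZkF k F) = carrier_vec k \<times> carrier F"
        unfolding vec_Zk(1)[symmetric] by (auto simp: ZkF_def image_iff)
    qed
  next
    fix a b assume "(a, b) \<in> R"
    then show "(fst (vec k (fst a), snd a), fst (vec k (fst b), snd b)) \<in> ?L"
      using R_lattice_rel by simp
  next
    fix a y assume "a \<in> carrier (ZkF k F)" "(fst (vec k (fst a), snd a), y) \<in> ?L"
    then show "\<exists>b. (a, b) \<in> R \<and> fst (vec k (fst b), snd b) = y"
      using lift_lattice_rel by simp
  next
    fix a b assume a: "a \<in> carrier (ZkF k F)" and b: "b \<in> carrier (ZkF k F)"
      and eq: "fst (vec k (fst a), snd a) = fst (vec k (fst b), snd b)"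
    obtain v x where vx: "a = (v, x)" "v \<in> Zk k" "x \<in> carrier F" using a by (cases a) (auto simp: carrier_ZkF)
    obtain v' x' where vx': "b = (v', x')" "v' \<in> Zk k" "x' \<in> carrier F" using b by (cases b) (auto simp: carrier_ZkF)
    have v: "v' = v" using inj_onD[OF vec_Zk(2), of v' v] eq vx vx' by simp
    have "phi_conj (ZkF k F) \<phi> (v, x) (v, x') \<longleftrightarrow> phi_conj F \<psi> x x'"
    proof
      assume "phi_conj (ZkF k F) \<phi> (v, x) (v, x')"
      then obtain w g where wg: "w \<in> Zk k" "g \<in> carrier F" "v = (\<lambda>i. w i + v i - fst (\<phi> (w, g)) i)"
        "x' = g \<otimes> x \<otimes> inv (snd (\<phi> (w, g)))"
        using phi_conj_iff[OF vx(2,3)] by blast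
      \<comment> \<open>Both elements lie over v, so the translation \<open>?z\<close> vanishes and
        injectivity forces w = 0. Only then is the F-component governed by \<psi> alone.\<close>
      let ?z = "(1\<^sub>m k - A) *\<^sub>v vec k w"
      have sum: "vec k v = vec k v + ?z"
        using vec_conj_fst[OF vx(2) wg(1,2)] wg(3) by simp
      have z: "?z \<in> carrier_vec k"
        by (rule mult_mat_vec_carrier[OF IA_carrier vec_carrier])
      have "u = 0\<^sub>v k" if "u \<in> carrier_vec k" "vec k v = vec k v + u" for u
      proof (rule eq_vecI)
        fix i assume "i < dim_vec (0\<^sub>v k)"
        then show "u $ i = 0\<^sub>v k $ i"
          using arg_cong[OF that(2), of "\<lambda>u. u $ i"] that(1) by simp
      qed (use that in simp)
      from this[OF z sum] have "?z = 0\<^sub>v k" .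
      then have "w = (\<lambda>_. 0)" using inj wg(1) by blast
      then show "phi_conj F \<psi> x x'" using wg by (auto simp: phi_conj_def \<phi>_zero)
    next
      assume "phi_conj F \<psi> x x'"
      then obtain g where "g \<in> carrier F" "x' = g \<otimes> x \<otimes> inv (\<psi> g)" by (auto simp: phi_conj_def)
      then show "phi_conj (ZkF k F) \<phi> (v, x) (v, x')"
        unfolding phi_conj_iff[OF vx(2,3)]
        by (intro bexI[of _ "\<lambda>_. 0"] bexI[of _ g]) (auto simp: \<phi>_zero)
    qed
    then show "((a, b) \<in> R) = ((snd (vec k (fst a), snd a), snd (vec k (fst b), snd b))
        \<in> {(a, b). a \<in> carrier F \<and> b \<in> carrier F \<and> phi_conj F \<psi> a b})"
      using a b vx vx' v by simp
  qed
  then show "card (reidemeister_classes (ZkF k F) \<phi>) = nat \<bar>det (1\<^sub>m k - A)\<bar> * card (reidemeister_classes F \<psi>)"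
    by (simp add: reidemeister_classes_eq_quotient lattice_index_eq_abs_det[OF IA_carrier])
qed

end

text \<open>The trace of a tensor product is the product of the traces, and the trace of the i-th
  exterior power is the sum of the principal minors of size i. Over all i these run through all
  subsets, which gives the expansion of the determinant.\<close>

lemma alternating_sum_trace_ext_tensor_B:
  assumes M: "M \<in> carrier_mat k k"
  shows "(\<Sum>i=0..k. (-1) ^ i * trace_ext_tensor_B k i M F \<psi>) =
    det (1\<^sub>m k - M) * (\<Sum>C\<in>conj_classes F. class_coord C (B_op F \<psi> (class_indicator C)))"
proof -
  let ?t = "\<Sum>C\<in>conj_classes F. class_coord C (B_op F \<psi> (class_indicator C))"
  have "(\<Sum>i=0..k. (-1) ^ i * trace_ext_tensor_B k i M F \<psi>)
      = (\<Sum>i=0..k. \<Sum>S\<in>ext_pow_basis k i. (-1) ^ card S * det (submatrix M S S)) * ?t"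
  proof (subst sum_distrib_right, rule sum.cong[OF refl])
    fix i
    have "trace_ext_tensor_B k i M F \<psi> = (\<Sum>S\<in>ext_pow_basis k i. det (submatrix M S S)) * ?t"
      by (simp add: trace_ext_tensor_B_def ext_pow_entry_def sum_product sum.cartesian_product)
    then have "(-1) ^ i * trace_ext_tensor_B k i M F \<psi>
      = (\<Sum>S\<in>ext_pow_basis k i. (-1) ^ i * det (submatrix M S S)) * ?t"
      by (simp only: mult.assoc flip: sum_distrib_left)
    also have "\<dots> = (\<Sum>S\<in>ext_pow_basis k i. (-1) ^ card S * det (submatrix M S S)) * ?t"
      by (intro arg_cong2[of _ _ _ _ "(*)"] sum.cong refl) (auto simp: ext_pow_basis_def)
    finally show "(-1) ^ i * trace_ext_tensor_B k i M F \<psi>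
      = (\<Sum>S\<in>ext_pow_basis k i. (-1) ^ card S * det (submatrix M S S)) * ?t" .
  qed
  also have "(\<Sum>i=0..k. \<Sum>S\<in>ext_pow_basis k i. (-1) ^ card S * det (submatrix M S S))
      = (\<Sum>S\<in>Pow {0..<k}. (-1) ^ card S * det (submatrix M S S))"
  proof -
    have basis: "ext_pow_basis k i = {S \<in> Pow {0..<k}. card S = i}" for i
      by (auto simp: ext_pow_basis_def)
    have sub: "card ` Pow {0..<k} \<subseteq> {0..k}"
      using card_mono[of "{0..<k}"] by fastforce
    show ?thesis unfolding basis by (rule sum.group) (use sub in auto)
  qed
  finally show ?thesis by (simp add: det_one_minus_eq_sum_principal_minors[OF M])
qed

theorem theorem5:
  fixes k :: nat
    and F :: "('a, 'b) monoid_scheme"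
    and \<phi> :: "(nat \<Rightarrow> int) \<times> 'a \<Rightarrow> (nat \<Rightarrow> int) \<times> 'a"
  assumes "group F"
    and "finite (carrier F)"
    and "\<phi> \<in> hom (ZkF k F) (ZkF k F)"
    and "finite (reidemeister_classes (ZkF k F) \<phi>)"
  shows "torsion_elems (ZkF k F) = {(\<lambda>_. 0, x) | x. x \<in> carrier F}
       \<and> \<phi> ` {(\<lambda>_. 0, x) | x. x \<in> carrier F} \<subseteq> {(\<lambda>_. 0, x) | x. x \<in> carrier F}
       \<and> (let M = phi_inf_mat k F \<phi>;
              p = eig_count M (\<lambda>\<mu>. \<mu> \<in> \<real> \<and> Re \<mu> < -1);
              r = eig_count M (\<lambda>\<mu>. \<mu> \<in> \<real> \<and> cmod \<mu> > 1)
          in of_nat (card (reidemeister_classes (ZkF k F) \<phi>))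
             = (-1) ^ (r + p) * (\<Sum>i=0..k. (-1) ^ i * trace_ext_tensor_B k i M F (phi_tors F \<phi>)))"
proof -
  interpret group F by fact
  interpret ZkF_endomorphism F k \<phi> by unfold_locales fact+
  let ?M = "phi_inf_mat k F \<phi>"
  let ?e = "eig_count ?M (\<lambda>\<mu>. \<mu> \<in> \<real> \<and> cmod \<mu> > 1) + eig_count ?M (\<lambda>\<mu>. \<mu> \<in> \<real> \<and> Re \<mu> < -1)"
  let ?t = "\<Sum>C\<in>conj_classes F. class_coord C (B_op F (phi_tors F \<phi>) (class_indicator C))"
  note card = card_reidemeister_classes[OF assms(4)]
  have M: "?M \<in> carrier_mat k k" by (simp add: phi_inf_mat_def)
  have "1\<^sub>m k - ?M = map_mat of_int (1\<^sub>m k - A)"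
    using A_carrier by (intro eq_matI) (auto simp: phi_inf_mat_eq)
  then have det: "det (1\<^sub>m k - ?M) = of_int (det (1\<^sub>m k - A))" by simp
  have "int (card (reidemeister_classes (ZkF k F) \<phi>))
      = \<bar>det (1\<^sub>m k - A)\<bar> * int (card (reidemeister_classes F (phi_tors F \<phi>)))"
    by (simp add: card(2))
  from arg_cong[OF this, of complex_of_int]
  have "complex_of_nat (card (reidemeister_classes (ZkF k F) \<phi>))
      = of_int \<bar>det (1\<^sub>m k - A)\<bar> * of_nat (card (reidemeister_classes F (phi_tors F \<phi>)))"
    by (simp only: of_int_mult of_int_of_nat_eq)
  \<comment> \<open>The absolute value becomes a sign times the determinant, and the class number of
    \<psi> becomes the trace of \<open>B\<close>.\<close>
  also have "\<dots> = (-1) ^ ?e * (det (1\<^sub>m k - ?M) * ?t)"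
    using abs_det_one_minus_eq_sign[OF A_carrier card(1)]
    by (simp add: card_reidemeister_classes_finite[OF finite_carrier \<psi>_hom] det[unfolded phi_inf_mat_eq] phi_inf_mat_eq)
  also have "det (1\<^sub>m k - ?M) * ?t = (\<Sum>i=0..k. (-1) ^ i * trace_ext_tensor_B k i ?M F (phi_tors F \<phi>))"
    by (rule alternating_sum_trace_ext_tensor_B[OF M, symmetric])
  finally show ?thesis
    unfolding Let_def using torsion_elems_ZkF[OF finite_carrier] \<phi>_torsion by blast
qed

end
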